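(* Let $0<m<\infty$ and let $(M,g)$ be a connected, complete, non-compact Riemannian manifold of dimension $n\ge 2$ admitting an $m$-modified gradient conformal vector field $\nabla f$, i.e. $f$ is a smooth function on $M$ satisfying $\mathrm{Hess} f-\frac1m df\otimes df=\sigma g$ for some smooth function $\sigma$ on $M$. Put $u=e^{-f/m}$. Suppose that $\mathrm{Ric}(\nabla u,\nabla u)\le 0$ on $M$ and that $|\nabla u|$ converges to zero at infinity. Then $f$ is constant.
   Context: $\mathrm{Hess}$ is the Hessian with respect to $g$, $\nabla$ applied to a function is its gradient, and $\mathrm{Ric}$ is the Ricci tensor. For $0<m<\infty$, an $m$-modified gradient conformal vector field is a gradient field $\nabla f$ with $\mathrm{Hess} f-\frac1m df\otimes df=\sigma g$ for some smooth function $\sigma$. A continuous function $h$ on a complete, non-compact Riemannian manifold $M$ converges to zero at infinity if $\lim_{d(x,x_0)\to\infty}h(x)=0$, where $d(\cdot,x_0)$ is the Riemannian distance from a fixed point $x_0\in M$. *)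

theory Defs
  imports "HOL-Analysis.Analysis"
begin

section \<open>Smooth functions on open subsets of Euclidean space\<close>

definition pdiff :: "'n::finite \<Rightarrow> (real^'n \<Rightarrow> 'b::real_normed_vector) \<Rightarrow> real^'n \<Rightarrow> 'b" where
  "pdiff i F x = frechet_derivative F (at x) (axis i 1)"

text \<open>The set \<open>S\<close> is meant to be open here and in \<open>smooth_on\<close>.\<close>

primrec Ck_on :: "nat \<Rightarrow> (real^'n::finite) set \<Rightarrow> (real^'n \<Rightarrow> 'b::real_normed_vector) \<Rightarrow> bool" where
  "Ck_on 0 S F \<longleftrightarrow> continuous_on S F"
| "Ck_on (Suc k) S F \<longleftrightarrow> F differentiable_on S \<and> (\<forall>i. Ck_on k S (pdiff i F))"

definition smooth_on :: "(real^'n::finite) set \<Rightarrow> (real^'n \<Rightarrow> 'b::real_normed_vector) \<Rightarrow> bool" where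
  "smooth_on S F \<longleftrightarrow> (\<forall>k. Ck_on k S F)"


section \<open>Riemannian geometry in coordinates\<close>

text \<open>
  Here \<open>G\<close> is the matrix \<open>(g\<^sub>i\<^sub>j)\<close> of metric components as a function of the coordinates
  and \<open>F\<close> is the coordinate expression of a scalar function.
\<close>

definition coord_inner :: "(real^'n::finite \<Rightarrow> real^'n^'n) \<Rightarrow> real^'n \<Rightarrow> real^'n \<Rightarrow> real^'n \<Rightarrow> real" where
  "coord_inner G x v w = (\<Sum>i\<in>UNIV. \<Sum>j\<in>UNIV. G x $ i $ j * v $ i * w $ j)"

definition coord_norm :: "(real^'n::finite \<Rightarrow> real^'n^'n) \<Rightarrow> real^'n \<Rightarrow> real^'n \<Rightarrow> real" where
  "coord_norm G x v = sqrt (coord_inner G x v v)"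

definition coord_gradient :: "(real^'n::finite \<Rightarrow> real^'n^'n) \<Rightarrow> (real^'n \<Rightarrow> real) \<Rightarrow> real^'n \<Rightarrow> real^'n" where
  "coord_gradient G F x = (\<chi> k. \<Sum>l\<in>UNIV. matrix_inv (G x) $ k $ l * pdiff l F x)"

text \<open>\<open>christoffel G k i j\<close> is the Levi-Civita symbol with upper index \<open>k\<close> and lower indices \<open>i j\<close>.\<close>

definition christoffel :: "(real^'n::finite \<Rightarrow> real^'n^'n) \<Rightarrow> 'n \<Rightarrow> 'n \<Rightarrow> 'n \<Rightarrow> real^'n \<Rightarrow> real" where
  "christoffel G k i j x = (1/2) * (\<Sum>l\<in>UNIV. matrix_inv (G x) $ k $ l *
     (pdiff i (\<lambda>y. G y $ j $ l) x + pdiff j (\<lambda>y. G y $ i $ l) x - pdiff l (\<lambda>y. G y $ i $ j) x))"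

definition coord_hessian :: "(real^'n::finite \<Rightarrow> real^'n^'n) \<Rightarrow> (real^'n \<Rightarrow> real) \<Rightarrow> real^'n \<Rightarrow> 'n \<Rightarrow> 'n \<Rightarrow> real" where
  "coord_hessian G F x i j =
     pdiff i (pdiff j F) x - (\<Sum>k\<in>UNIV. christoffel G k i j x * pdiff k F x)"

text \<open>
  \<open>riemann G l k i j\<close> is the \<open>l\<close>-th component of \<open>R(\<partial>\<^sub>i, \<partial>\<^sub>j) \<partial>\<^sub>k\<close> with
  \<open>R(X,Y) Z = \<nabla>\<^sub>X \<nabla>\<^sub>Y Z - \<nabla>\<^sub>Y \<nabla>\<^sub>X Z - \<nabla>\<^bsub>[X,Y]\<^esub> Z\<close>, and \<open>Ric(Y,Z)\<close> is the trace of
  \<open>X \<mapsto> R(X,Y) Z\<close>, so that round spheres have positive Ricci curvature.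
\<close>

definition riemann :: "(real^'n::finite \<Rightarrow> real^'n^'n) \<Rightarrow> 'n \<Rightarrow> 'n \<Rightarrow> 'n \<Rightarrow> 'n \<Rightarrow> real^'n \<Rightarrow> real" where
  "riemann G l k i j x =
     pdiff i (christoffel G l j k) x - pdiff j (christoffel G l i k) x
     + (\<Sum>m\<in>UNIV. christoffel G l i m x * christoffel G m j k x)
     - (\<Sum>m\<in>UNIV. christoffel G l j m x * christoffel G m i k x)"

definition coord_Ric :: "(real^'n::finite \<Rightarrow> real^'n^'n) \<Rightarrow> real^'n \<Rightarrow> real^'n \<Rightarrow> real^'n \<Rightarrow> real" where
  "coord_Ric G x v w = (\<Sum>j\<in>UNIV. \<Sum>k\<in>UNIV. (\<Sum>i\<in>UNIV. riemann G i k i j x) * v $ j * w $ k)"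


section \<open>Riemannian manifolds\<close>

text \<open>A chart is a pair of its domain and its coordinate map; the latter matters on the domain only.\<close>

type_synonym ('m, 'n) chart = "'m set \<times> ('m \<Rightarrow> real^'n)"

definition chart_dom :: "('m, 'n::finite) chart \<Rightarrow> 'm set" where
  "chart_dom c = fst c"

definition coord :: "('m, 'n::finite) chart \<Rightarrow> 'm \<Rightarrow> real^'n" where
  "coord c = snd c"

definition chart_image :: "('m, 'n::finite) chart \<Rightarrow> (real^'n) set" where
  "chart_image c = coord c ` chart_dom c"

definition param :: "('m, 'n::finite) chart \<Rightarrow> real^'n \<Rightarrow> 'm" where
  "param c = inv_into (chart_dom c) (coord c)"

definition is_chart :: "('m::topological_space, 'n::finite) chart \<Rightarrow> bool" where
  "is_chart c \<longleftrightarrow> open (chart_dom c) \<and> open (chart_image c) \<and> homeomorphism (chart_dom c) (chart_image c) (coord c) (param c)"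

definition transition :: "('m, 'n::finite) chart \<Rightarrow> ('m, 'n) chart \<Rightarrow> real^'n \<Rightarrow> real^'n" where
  "transition c d = coord d \<circ> param c"

text \<open>The manifold is the whole type \<open>'m\<close>; the atlas \<open>A\<close> is not required to be maximal.\<close>

locale smooth_manifold =
  fixes A :: "('m::{t2_space, second_countable_topology}, 'n::finite) chart set"
  assumes charts: "\<And>c. c \<in> A \<Longrightarrow> is_chart c"
    and covering: "(\<Union>c\<in>A. chart_dom c) = UNIV"
    and compatible:
      "\<And>c d. c \<in> A \<Longrightarrow> d \<in> A \<Longrightarrow> smooth_on (coord c ` (chart_dom c \<inter> chart_dom d)) (transition c d)"

text \<open>
  A Riemannian metric is given by its component matrices \<open>g c\<close> in every chart \<open>c\<close>, as functions of
  the coordinates; the last axiom is the transformation law of covariant 2-tensors.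
\<close>

locale riemannian_manifold = smooth_manifold A
  for A :: "('m::{t2_space, second_countable_topology}, 'n::finite) chart set" +
  fixes g :: "('m, 'n) chart \<Rightarrow> real^'n \<Rightarrow> real^'n^'n"
  assumes metric_smooth: "\<And>c. c \<in> A \<Longrightarrow> smooth_on (chart_image c) (g c)"
    and metric_sym: "\<And>c x. c \<in> A \<Longrightarrow> x \<in> chart_image c \<Longrightarrow> transpose (g c x) = g c x"
    and metric_pos: "\<And>c x v. c \<in> A \<Longrightarrow> x \<in> chart_image c \<Longrightarrow> v \<noteq> 0 \<Longrightarrow> coord_inner (g c) x v v > 0"
    and metric_transform: "\<And>c d p. c \<in> A \<Longrightarrow> d \<in> A \<Longrightarrow> p \<in> chart_dom c \<inter> chart_dom d \<Longrightarrow>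
        (let J = jacobian (transition c d) (at (coord c p))
         in g c (coord c p) = transpose J ** g d (coord d p) ** J)"

definition smooth_fun :: "('m, 'n::finite) chart set \<Rightarrow> ('m \<Rightarrow> real) \<Rightarrow> bool" where
  "smooth_fun A f \<longleftrightarrow> (\<forall>c\<in>A. smooth_on (chart_image c) (f \<circ> param c))"

text \<open>An arbitrary choice; the quantities defined with it below do not depend on the chart.\<close>

definition chart_at :: "('m, 'n::finite) chart set \<Rightarrow> 'm \<Rightarrow> ('m, 'n) chart" where
  "chart_at A p = (SOME c. c \<in> A \<and> p \<in> chart_dom c)"

subsection \<open>Riemannian distance\<close>

definition C1_curve_on ::
    "('m, 'n::finite) chart set \<Rightarrow> (real \<Rightarrow> 'm) \<Rightarrow> real \<Rightarrow> real \<Rightarrow> bool" where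
  "C1_curve_on A \<gamma> a b \<longleftrightarrow>
     (\<forall>c\<in>A. let T = {t\<in>{a..b}. \<gamma> t \<in> chart_dom c} in
        \<exists>D. (\<forall>t\<in>T. ((coord c \<circ> \<gamma>) has_vector_derivative D t) (at t within {a..b}))
          \<and> continuous_on T D)"

text \<open>
  With \<open>K\<close> the set of break points, the curve is \<open>C\<^sup>1\<close> up to the end points (with one-sided
  derivatives there) on every closed interval having no break point in its interior.
\<close>

definition piecewise_C1_curve ::
    "('m::topological_space, 'n::finite) chart set \<Rightarrow> (real \<Rightarrow> 'm) \<Rightarrow> bool" where
  "piecewise_C1_curve A \<gamma> \<longleftrightarrow> path \<gamma> \<and>
     (\<exists>K. finite K \<and>
        (\<forall>a b. 0 \<le> a \<longrightarrow> a < b \<longrightarrow> b \<le> 1 \<longrightarrow> {a<..<b} \<inter> K = {} \<longrightarrow> C1_curve_on A \<gamma> a b))"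

definition speed :: "('m, 'n::finite) chart set \<Rightarrow> (('m, 'n) chart \<Rightarrow> real^'n \<Rightarrow> real^'n^'n)
    \<Rightarrow> (real \<Rightarrow> 'm) \<Rightarrow> real \<Rightarrow> real" where
  "speed A g \<gamma> t = (let c = chart_at A (\<gamma> t) in
     coord_norm (g c) (coord c (\<gamma> t)) (vector_derivative (coord c \<circ> \<gamma>) (at t)))"

definition curve_length :: "('m, 'n::finite) chart set \<Rightarrow> (('m, 'n) chart \<Rightarrow> real^'n \<Rightarrow> real^'n^'n)
    \<Rightarrow> (real \<Rightarrow> 'm) \<Rightarrow> real" where
  "curve_length A g \<gamma> = integral {0..1} (speed A g \<gamma>)"

text \<open>The infimum is over a nonempty set only if the two points lie in the same component.\<close>

definition riem_dist :: "('m::topological_space, 'n::finite) chart set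
    \<Rightarrow> (('m, 'n) chart \<Rightarrow> real^'n \<Rightarrow> real^'n^'n) \<Rightarrow> 'm \<Rightarrow> 'm \<Rightarrow> real" where
  "riem_dist A g p q =
     Inf {curve_length A g \<gamma> |\<gamma>. piecewise_C1_curve A \<gamma> \<and> pathstart \<gamma> = p \<and> pathfinish \<gamma> = q}"

definition complete_riemannian :: "('m::topological_space, 'n::finite) chart set
    \<Rightarrow> (('m, 'n) chart \<Rightarrow> real^'n \<Rightarrow> real^'n^'n) \<Rightarrow> bool" where
  "complete_riemannian A g \<longleftrightarrow> Metric_space.mcomplete UNIV (riem_dist A g)"

definition zero_at_infinity :: "('m::topological_space, 'n::finite) chart set
    \<Rightarrow> (('m, 'n) chart \<Rightarrow> real^'n \<Rightarrow> real^'n^'n) \<Rightarrow> 'm \<Rightarrow> ('m \<Rightarrow> real) \<Rightarrow> bool" where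
  "zero_at_infinity A g x0 h \<longleftrightarrow> (h \<longlongrightarrow> 0) (filtercomap (\<lambda>x. riem_dist A g x x0) at_top)"

subsection \<open>Gradients and modified gradient conformal vector fields\<close>

definition gradient :: "(('m, 'n::finite) chart \<Rightarrow> real^'n \<Rightarrow> real^'n^'n)
    \<Rightarrow> ('m \<Rightarrow> real) \<Rightarrow> ('m, 'n) chart \<Rightarrow> 'm \<Rightarrow> real^'n" where
  "gradient g u c p = coord_gradient (g c) (u \<circ> param c) (coord c p)"

definition gradient_norm :: "('m, 'n::finite) chart set \<Rightarrow> (('m, 'n) chart \<Rightarrow> real^'n \<Rightarrow> real^'n^'n)
    \<Rightarrow> ('m \<Rightarrow> real) \<Rightarrow> 'm \<Rightarrow> real" where
  "gradient_norm A g u p =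
     (let c = chart_at A p in coord_norm (g c) (coord c p) (gradient g u c p))"

definition Ric :: "(('m, 'n::finite) chart \<Rightarrow> real^'n \<Rightarrow> real^'n^'n)
    \<Rightarrow> ('m, 'n) chart \<Rightarrow> 'm \<Rightarrow> real^'n \<Rightarrow> real^'n \<Rightarrow> real" where
  "Ric g c p v w = coord_Ric (g c) (coord c p) v w"

definition hessian :: "(('m, 'n::finite) chart \<Rightarrow> real^'n \<Rightarrow> real^'n^'n)
    \<Rightarrow> ('m \<Rightarrow> real) \<Rightarrow> ('m, 'n) chart \<Rightarrow> 'm \<Rightarrow> 'n \<Rightarrow> 'n \<Rightarrow> real" where
  "hessian g f c p i j = coord_hessian (g c) (f \<circ> param c) (coord c p) i j"

definition differential :: "('m \<Rightarrow> real) \<Rightarrow> ('m, 'n::finite) chart \<Rightarrow> 'm \<Rightarrow> 'n \<Rightarrow> real" where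
  "differential f c p i = pdiff i (f \<circ> param c) (coord c p)"

text \<open>The potential \<open>f\<close>, rather than the field \<open>\<nabla> f\<close>, is the argument.\<close>

definition modified_gradient_conformal :: "real \<Rightarrow> ('m, 'n::finite) chart set
    \<Rightarrow> (('m, 'n) chart \<Rightarrow> real^'n \<Rightarrow> real^'n^'n) \<Rightarrow> ('m \<Rightarrow> real) \<Rightarrow> bool" where
  "modified_gradient_conformal m A g f \<longleftrightarrow> smooth_fun A f \<and>
     (\<exists>\<sigma>. smooth_fun A \<sigma> \<and>
        (\<forall>c\<in>A. \<forall>p\<in>chart_dom c. \<forall>i j.
           hessian g f c p i j - (1/m) * (differential f c p i * differential f c p j)
             = \<sigma> p * g c (coord c p) $ i $ j))"

end

theory Submission
  imports Defs
begin

text \<open>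
  With \<open>u = exp (- f / m)\<close> and \<open>X = \<nabla> u\<close> the hypothesis becomes \<open>Hess u = \<psi> g\<close>, that is \<open>\<nabla>\<^sub>Y X = \<psi> Y\<close>.
  Commuting derivatives of \<open>X\<close> gives \<open>Ric(X, X) = - (n - 1) d\<psi>(X)\<close>, so \<open>d\<psi>(X) \<ge> 0\<close>, while
  \<open>h = |X|\<^sup>2\<close> satisfies \<open>dh = 2 \<psi> du\<close>. For \<open>e > 0\<close> put \<open>w = h + e exp (- u)\<close>; then \<open>dw = a du\<close> with
  \<open>a = 2 \<psi> - e exp (- u)\<close>. At a local maximum of \<open>w\<close> with \<open>h > 0\<close> one has \<open>a = 0\<close>, and the second derivative of
  \<open>w\<close> in the direction \<open>X\<close> is \<open>da(X) du(X) \<ge> e exp (- u) h\<^sup>2 > 0\<close>, which is absurd. If \<open>h\<close> were positive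
  somewhere, then for small \<open>e\<close> the function \<open>w\<close> would attain its maximum at a point with \<open>h > 0\<close>: since \<open>0 < exp (- u) < 1\<close>
  and \<open>h\<close> tends to zero at infinity, only a closed ball matters, and closed balls are compact by completeness.
\<close>

section \<open>Partial derivatives\<close>

text \<open>At a maximum of \<open>h\<close> alone the second derivative along \<open>X\<close> is
  only known to be nonnegative, which is no contradiction; the perturbation supplies strictness. It
  has to be a function of \<open>u\<close>, so that \<open>dw\<close> stays a multiple of
  \<open>du\<close>; strictly convex in \<open>u\<close>, so that its share of \<open>da(X)\<close>
  is positive; and bounded, so that it cannot spoil the decay of \<open>h\<close>. As
  \<open>u > 0\<close>, the function \<open>exp (- u)\<close> does all this. The passage from
  \<open>f\<close> to \<open>u\<close> works because differentiating an exponential twice produces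
  the term quadratic in \<open>df\<close>. Two matters lie outside this computation.
  \<open>gradient_norm\<close> is evaluated in an arbitrarily chosen chart, so its square must be
  shown independent of the chart before it can be differentiated. Completeness speaks of a distance
  defined as an infimum of lengths, so compactness of balls rests on three facts about that infimum:
  it induces the given topology, small balls are compact, and cutting a curve splits distances
  almost additively.\<close>

lemma pdiff_eq: "(F has_derivative F') (at x) \<Longrightarrow> pdiff i F x = F' (axis i 1)"
  unfolding pdiff_def by (metis frechet_derivative_at)

lemma has_derivative_pdiff:
  fixes F :: "real^'n::finite \<Rightarrow> 'b::real_normed_vector"
  assumes "F differentiable (at x)"
  shows "(F has_derivative (\<lambda>v. \<Sum>i\<in>UNIV. v $ i *\<^sub>R pdiff i F x)) (at x)"
proof -
  obtain F' where F': "(F has_derivative F') (at x)"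
    using assms differentiable_def by blast
  interpret F': bounded_linear F'
    using F' has_derivative_bounded_linear by blast
  have "F' v = (\<Sum>i\<in>UNIV. v $ i *\<^sub>R pdiff i F x)" for v
  proof -
    have "F' v = F' (\<Sum>i\<in>UNIV. v $ i *\<^sub>R axis i 1)"
      by (simp add: basis_expansion[of v, unfolded scalar_mult_eq_scaleR])
    then show ?thesis
      by (simp add: F'.sum F'.scaleR pdiff_eq[OF F'])
  qed
  then show ?thesis
    using F' by (simp add: has_derivative_eq_rhs ext)
qed

lemma pdiff_cong:
  assumes "open S" "x \<in> S" "\<And>y. y \<in> S \<Longrightarrow> F y = H y"
  shows "pdiff i F x = pdiff i H x"
proof -
  have "(F has_derivative F') (at x) \<longleftrightarrow> (H has_derivative F') (at x)" for F'
    using assms has_derivative_transform_within_open[of F F' x UNIV S H]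
      has_derivative_transform_within_open[of H F' x UNIV S F] by auto
  then show ?thesis
    unfolding pdiff_def frechet_derivative_def by simp
qed

lemma pdiff_const: "pdiff i (\<lambda>x. c) x = 0"
  by (rule pdiff_eq[THEN trans]) (auto intro: derivative_eq_intros)

lemma pdiff_mult:
  fixes f h :: "real^'n::finite \<Rightarrow> real"
  assumes "f differentiable (at x)" "h differentiable (at x)"
  shows "pdiff i (\<lambda>x. f x * h x) x = pdiff i f x * h x + f x * pdiff i h x"
proof -
  obtain f' h' where *: "(f has_derivative f') (at x)" "(h has_derivative h') (at x)"
    using assms differentiable_def by blast
  show ?thesis
    using pdiff_eq[OF has_derivative_mult[OF *]] by (simp add: pdiff_eq[OF *(1)] pdiff_eq[OF *(2)])
qed

lemma pdiff_diff:
  assumes "f differentiable (at x)" "h differentiable (at x)"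
  shows "pdiff i (\<lambda>x. f x - h x) x = pdiff i f x - pdiff i h x"
proof -
  obtain f' h' where *: "(f has_derivative f') (at x)" "(h has_derivative h') (at x)"
    using assms differentiable_def by blast
  show ?thesis
    using pdiff_eq[OF has_derivative_diff[OF *]] by (simp add: pdiff_eq[OF *(1)] pdiff_eq[OF *(2)])
qed

lemma pdiff_add:
  assumes "f differentiable (at x)" "h differentiable (at x)"
  shows "pdiff i (\<lambda>x. f x + h x) x = pdiff i f x + pdiff i h x"
proof -
  obtain f' h' where *: "(f has_derivative f') (at x)" "(h has_derivative h') (at x)"
    using assms differentiable_def by blast
  show ?thesis
    using pdiff_eq[OF has_derivative_add[OF *]] by (simp add: pdiff_eq[OF *(1)] pdiff_eq[OF *(2)])
qed

lemma pdiff_cmult: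
  fixes f :: "real^'n::finite \<Rightarrow> real"
  shows "f differentiable (at x) \<Longrightarrow> pdiff i (\<lambda>x. c * f x) x = c * pdiff i f x"
  by (simp add: pdiff_mult pdiff_const)

lemma pdiff_sum:
  assumes "\<And>a. a \<in> A \<Longrightarrow> f a differentiable (at x)"
  shows "pdiff i (\<lambda>x. \<Sum>a\<in>A. f a x) x = (\<Sum>a\<in>A. pdiff i (f a) x)"
proof -
  have "((\<lambda>x. \<Sum>a\<in>A. f a x) has_derivative (\<lambda>v. \<Sum>a\<in>A. frechet_derivative (f a) (at x) v)) (at x)"
    using assms by (intro has_derivative_sum) (simp add: frechet_derivative_works)
  from pdiff_eq[OF this] show ?thesis by (simp add: pdiff_def)
qed

lemma pdiff_exp:
  fixes f :: "real^'n::finite \<Rightarrow> real"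
  assumes "f differentiable (at x)"
  shows "pdiff i (\<lambda>x. exp (f x)) x = exp (f x) * pdiff i f x"
proof -
  obtain f' where f': "(f has_derivative f') (at x)"
    using assms differentiable_def by blast
  then show ?thesis
    using has_derivative_exp[OF f', THEN pdiff_eq, of i] by (simp add: pdiff_eq)
qed

lemma differentiable_vec_nth:
  fixes F :: "'a::real_normed_vector \<Rightarrow> 'b::euclidean_space^'n::finite"
  shows "F differentiable net \<Longrightarrow> (\<lambda>x. F x $ j) differentiable net"
  unfolding differentiable_def
  using bounded_linear.has_derivative[OF bounded_linear_vec_nth] by blast

lemma pdiff_vec_nth:
  fixes F :: "real^'n::finite \<Rightarrow> 'b::euclidean_space^'k::finite"
  assumes "F differentiable (at x)"
  shows "pdiff i (\<lambda>x. F x $ j) x = pdiff i F x $ j"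
proof -
  obtain F' where F': "(F has_derivative F') (at x)"
    using assms differentiable_def by blast
  then have "((\<lambda>x. F x $ j) has_derivative (\<lambda>v. F' v $ j)) (at x)"
    by (rule bounded_linear.has_derivative[OF bounded_linear_vec_nth])
  then show ?thesis
    using F' by (simp add: pdiff_eq)
qed

lemma differentiable_exp:
  fixes f :: "'a::real_normed_vector \<Rightarrow> real"
  shows "f differentiable (at x) \<Longrightarrow> (\<lambda>x. exp (f x)) differentiable (at x)"
  using has_derivative_exp unfolding differentiable_def by blast

section \<open>Determinants and inverse matrices depending on a point\<close>

lemma differentiable_prod:
  fixes f :: "'i \<Rightarrow> 'a::real_normed_vector \<Rightarrow> real"
  assumes "\<And>i. i \<in> I \<Longrightarrow> f i differentiable (at x)"
  shows "(\<lambda>x. \<Prod>i\<in>I. f i x) differentiable (at x)"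
  using assms
  by (induction I rule: infinite_finite_induct) (auto intro: differentiable_mult)

lemma differentiable_det:
  fixes M :: "'a::real_normed_vector \<Rightarrow> real^'n^'n::finite"
  assumes "\<And>i j. (\<lambda>x. M x $ i $ j) differentiable (at x)"
  shows "(\<lambda>x. det (M x)) differentiable (at x)"
  unfolding det_def
  by (intro differentiable_sum ballI differentiable_mult differentiable_const differentiable_prod assms)
    (simp add: finite_permutations)

lemma matrix_inv:
  assumes "invertible (A :: 'a::semiring_1^'n^'m)"
  shows "A ** matrix_inv A = mat 1" "matrix_inv A ** A = mat 1"
  using someI_ex[OF assms[unfolded invertible_def]] by (auto simp: matrix_inv_def)

text \<open>Cramer's rule exhibits the entries of the inverse as quotients of determinants.\<close>

lemma differentiable_matrix_inv:
  fixes M :: "'a::real_normed_vector \<Rightarrow> real^'n^'n::finite"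
  assumes d: "\<And>i j. (\<lambda>x. M x $ i $ j) differentiable (at x)"
    and "open S" "x \<in> S" and inv: "\<And>y. y \<in> S \<Longrightarrow> invertible (M y)"
  shows "(\<lambda>x. matrix_inv (M x) $ k $ l) differentiable (at x)"
proof -
  let ?N = "\<lambda>y. (\<chi> i j. if j = k then (axis l 1::real^'n) $ i else M y $ i $ j)"
  have eq: "matrix_inv (M y) $ k $ l = det (?N y) / det (M y)" if "y \<in> S" for y
  proof -
    have nz: "det (M y) \<noteq> 0"
      using inv that by (simp add: invertible_det_nz)
    \<comment> \<open>Column \<open>l\<close> of the inverse solves the system with right-hand side
      \<open>axis l 1\<close>; \<open>?N y\<close> is \<open>M y\<close> with column
      \<open>k\<close> replaced by that vector.\<close>
    have "M y *v (matrix_inv (M y) *v axis l 1) = axis l 1"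
      using inv[OF that] by (simp add: matrix_vector_mul_assoc matrix_inv)
    with cramer[OF nz, THEN iffD1, OF this] show ?thesis
      by (simp add: matrix_vector_mul_component row_def inner_axis vec_eq_iff)
  qed
  have "(\<lambda>y. det (?N y) / det (M y)) differentiable (at x)"
  proof (intro differentiable_divide differentiable_det)
    show "(\<lambda>y. ?N y $ i $ j) differentiable (at x)" for i j
      using d by (cases "j = k") auto
    show "det (M x) \<noteq> 0"
      using inv assms(3) by (simp add: invertible_det_nz)
  qed (fact d)
  then obtain D where "((\<lambda>y. det (?N y) / det (M y)) has_derivative D) (at x)"
    unfolding differentiable_def by blast
  from has_derivative_transform_within_open[OF this assms(2,3) eq[symmetric]] show ?thesis
    by (rule differentiableI)
qed

section \<open>Symmetry of mixed second partial derivatives\<close>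

lemma has_derivative_line:
  fixes F :: "real^'n::finite \<Rightarrow> real"
  assumes "F differentiable (at (x + t *\<^sub>R v))"
  shows "((\<lambda>t. F (x + t *\<^sub>R v)) has_real_derivative (\<Sum>i\<in>UNIV. v $ i * pdiff i F (x + t *\<^sub>R v))) (at t)"
proof -
  have l: "((\<lambda>t. x + t *\<^sub>R v) has_derivative (\<lambda>s. s *\<^sub>R v)) (at t)"
    by (auto intro!: derivative_eq_intros)
  from diff_chain_at[OF l has_derivative_pdiff[OF assms]] show ?thesis
    unfolding has_field_derivative_def o_def
    by (rule has_derivative_eq_rhs) (auto simp: fun_eq_iff sum_distrib_left sum_distrib_right mult_ac)
qed

text \<open>The mean value theorem in direction \<open>i\<close> turns the second difference into
  \<open>t\<close> times a difference of two values of \<open>pdiff i F\<close> near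
  \<open>x\<close>; differentiability of \<open>pdiff i F\<close> at the single point
  \<open>x\<close> then estimates each of them.\<close>

lemma second_difference:
  fixes F :: "real^'n::finite \<Rightarrow> real"
  assumes "open S" "x \<in> S" and F: "\<And>y. y \<in> S \<Longrightarrow> F differentiable (at y)"
    and P: "pdiff i F differentiable (at x)" and "e > 0"
  shows "\<exists>d>0. \<forall>t. 0 < t \<longrightarrow> t < d \<longrightarrow>
    \<bar>F (x + t *\<^sub>R axis i 1 + t *\<^sub>R axis j 1) - F (x + t *\<^sub>R axis i 1) - F (x + t *\<^sub>R axis j 1) + F x
      - t\<^sup>2 * pdiff j (pdiff i F) x\<bar> \<le> e * t\<^sup>2"
proof -
  define P' where "P' = frechet_derivative (pdiff i F) (at x)"
  have P': "(pdiff i F has_derivative P') (at x)"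
    using P P'_def frechet_derivative_works by auto
  interpret P': bounded_linear P'
    using P' has_derivative_bounded_linear by blast
  obtain d1 where d1: "d1 > 0"
    "\<And>y. norm (y - x) < d1 \<Longrightarrow> \<bar>pdiff i F y - pdiff i F x - P' (y - x)\<bar> \<le> (e/3) * norm (y - x)"
    using P'[unfolded has_derivative_at_alt] \<open>e > 0\<close> by (metis real_norm_def divide_pos_pos zero_less_numeral)
  obtain d2 where d2: "d2 > 0" "ball x d2 \<subseteq> S"
    using assms(1,2) open_contains_ball by blast
  \<comment> \<open>Halved because the points used are only known to lie within \<open>2 * t\<close>
    of \<open>x\<close>.\<close>
  define d where "d = min d1 d2 / 2"
  let ?a = "axis i 1 :: real^'n" and ?b = "axis j 1 :: real^'n"
  have na: "norm ?a = 1" "norm ?b = 1" by (auto simp: norm_axis_1)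
  have "\<bar>F (x + t *\<^sub>R ?a + t *\<^sub>R ?b) - F (x + t *\<^sub>R ?a) - F (x + t *\<^sub>R ?b) + F x
      - t\<^sup>2 * pdiff j (pdiff i F) x\<bar> \<le> e * t\<^sup>2" if t: "0 < t" "t < d" for t
  proof -
    have nrm: "norm (s *\<^sub>R ?a + t *\<^sub>R ?b) \<le> 2 * t" "norm (s *\<^sub>R ?a) \<le> t" if "0 \<le> s" "s \<le> t" for s
      using norm_triangle_ineq[of "s *\<^sub>R ?a" "t *\<^sub>R ?b"] that na by auto
    have dd: "2 * t < d1" "2 * t < d2" using t d_def by auto
    have S1: "x + t *\<^sub>R ?b + s *\<^sub>R ?a \<in> S" if "0 \<le> s" "s \<le> t" for s
      using nrm(1)[OF that] dd d2 by (intro subsetD[OF d2(2)]) (simp add: dist_norm algebra_simps norm_minus_commute)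
    have S2: "x + s *\<^sub>R ?a \<in> S" if "0 \<le> s" "s \<le> t" for s
      using nrm(2)[OF that] dd d2 t by (intro subsetD[OF d2(2)]) (simp add: dist_norm)
    have sa: "(\<Sum>k\<in>UNIV. ?a $ k * pdiff k F y) = pdiff i F y" for y
      by (simp add: axis_def if_distrib[where f="\<lambda>r. r * _"] cong: if_cong)
    define \<phi> where "\<phi> s = F (x + t *\<^sub>R ?b + s *\<^sub>R ?a) - F (x + s *\<^sub>R ?a)" for s
    have "(\<phi> has_real_derivative (pdiff i F (x + t *\<^sub>R ?b + s *\<^sub>R ?a) - pdiff i F (x + s *\<^sub>R ?a))) (at s)"
      if "0 \<le> s" "s \<le> t" for s
      unfolding \<phi>_def
      by (intro DERIV_diff has_derivative_line[THEN DERIV_cong[OF _ sa]] F S1 S2 that)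
    from MVT2[OF t(1) this] obtain s where s: "0 < s" "s < t"
      "\<phi> t - \<phi> 0 = (t - 0) * (pdiff i F (x + t *\<^sub>R ?b + s *\<^sub>R ?a) - pdiff i F (x + s *\<^sub>R ?a))"
      by auto
    \<comment> \<open>\<open>A\<close> and \<open>B\<close> are the errors of the linear
      approximation at two points within \<open>2 * t\<close> and \<open>t\<close> of
      \<open>x\<close>; with factor \<open>e/3\<close> they add up to at most
      \<open>e * t\<close>.\<close>
    define A where "A = pdiff i F (x + t *\<^sub>R ?b + s *\<^sub>R ?a) - pdiff i F x - P' (s *\<^sub>R ?a + t *\<^sub>R ?b)"
    define B where "B = pdiff i F (x + s *\<^sub>R ?a) - pdiff i F x - P' (s *\<^sub>R ?a)"
    have "\<bar>A\<bar> \<le> (e/3) * norm (s *\<^sub>R ?a + t *\<^sub>R ?b)"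
      using d1(2)[of "x + t *\<^sub>R ?b + s *\<^sub>R ?a"] nrm(1)[of s] s dd unfolding A_def
      by (simp add: algebra_simps)
    also have "\<dots> \<le> (e/3) * (2 * t)"
      using nrm(1)[of s] s \<open>e > 0\<close> by (intro mult_left_mono) auto
    finally have A: "\<bar>A\<bar> \<le> (e/3) * (2 * t)" .
    have "\<bar>B\<bar> \<le> (e/3) * norm (s *\<^sub>R ?a)"
      using d1(2)[of "x + s *\<^sub>R ?a"] nrm(2)[of s] s dd t unfolding B_def by simp
    also have "\<dots> \<le> (e/3) * t"
      using nrm(2)[of s] s \<open>e > 0\<close> by (intro mult_left_mono) auto
    finally have B: "\<bar>B\<bar> \<le> (e/3) * t" .
    have PB: "pdiff j (pdiff i F) x = P' ?b"
      using pdiff_eq[OF P'] .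
    have "F (x + t *\<^sub>R ?a + t *\<^sub>R ?b) - F (x + t *\<^sub>R ?a) - F (x + t *\<^sub>R ?b) + F x = \<phi> t - \<phi> 0"
      by (simp add: \<phi>_def algebra_simps)
    also have "\<dots> = t * (A - B + P' (t *\<^sub>R ?b))"
      using s(3) by (simp add: A_def B_def P'.add)
    also have "\<dots> = t * (A - B) + t\<^sup>2 * P' ?b"
      by (simp add: P'.scaleR algebra_simps power2_eq_square)
    finally have "\<bar>F (x + t *\<^sub>R ?a + t *\<^sub>R ?b) - F (x + t *\<^sub>R ?a) - F (x + t *\<^sub>R ?b) + F x
      - t\<^sup>2 * pdiff j (pdiff i F) x\<bar> = t * \<bar>A - B\<bar>"
      using t PB by (simp add: abs_mult)
    also have "\<dots> \<le> t * (e * t)"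
      using A B t by (intro mult_left_mono) (auto simp: field_simps)
    finally show ?thesis by (simp add: power2_eq_square mult_ac)
  qed
  moreover have "d > 0" using d1 d2 d_def by auto
  ultimately show ?thesis by blast
qed

text \<open>The second difference is symmetric in \<open>i\<close> and \<open>j\<close>, so divided
  by \<open>t\<^sup>2\<close> it approximates both mixed partials.\<close>

lemma pdiff_commute:
  fixes F :: "real^'n::finite \<Rightarrow> real"
  assumes "open S" "x \<in> S" and F: "\<And>y. y \<in> S \<Longrightarrow> F differentiable (at y)"
    and i: "pdiff i F differentiable (at x)" and j: "pdiff j F differentiable (at x)"
  shows "pdiff j (pdiff i F) x = pdiff i (pdiff j F) x"
proof (rule ccontr)
  let ?L = "pdiff j (pdiff i F) x" and ?R = "pdiff i (pdiff j F) x"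
  assume "?L \<noteq> ?R"
  \<comment> \<open>A third of the gap: the two approximations together allow a gap of
    \<open>2 * e\<close> at most, whereas it is \<open>3 * e\<close>.\<close>
  define e where "e = \<bar>?L - ?R\<bar> / 3"
  have e: "e > 0" using \<open>?L \<noteq> ?R\<close> by (simp add: e_def)
  let ?D = "\<lambda>t. F (x + t *\<^sub>R axis i 1 + t *\<^sub>R axis j 1) - F (x + t *\<^sub>R axis i 1) - F (x + t *\<^sub>R axis j 1) + F x"
  obtain d1 where d1: "d1 > 0" "\<And>t. 0 < t \<Longrightarrow> t < d1 \<Longrightarrow> \<bar>?D t - t\<^sup>2 * ?L\<bar> \<le> e * t\<^sup>2"
    using second_difference[OF assms(1-3) i e, of j] by auto
  obtain d2 where d2: "d2 > 0" "\<And>t. 0 < t \<Longrightarrow> t < d2 \<Longrightarrow> \<bar>?D t - t\<^sup>2 * ?R\<bar> \<le> e * t\<^sup>2"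
    using second_difference[OF assms(1-3) j e, of i] by (auto simp: algebra_simps)
  define t where "t = min d1 d2 / 2"
  have t: "0 < t" "t < d1" "t < d2" using d1(1) d2(1) by (auto simp: t_def)
  have "t\<^sup>2 * \<bar>?L - ?R\<bar> = \<bar>t\<^sup>2 * ?L - t\<^sup>2 * ?R\<bar>"
    by (simp add: abs_mult flip: right_diff_distrib)
  also have "\<dots> \<le> t\<^sup>2 * (2 * e)"
    using d1(2)[OF t(1,2)] d2(2)[OF t(1,3)] by (simp add: algebra_simps)
  finally have "\<bar>?L - ?R\<bar> \<le> 2 * e" using t by simp
  then show False using e e_def by auto
qed

section \<open>Conformal gradient fields in a chart\<close>

text \<open>Two orders of differentiability, because the Christoffel symbols contain first partials
  of the metric and the curvature differentiates them again.\<close>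

locale metric_chart =
  fixes S :: "(real^'n::finite) set" and G :: "real^'n \<Rightarrow> real^'n^'n"
  assumes open_S: "open S"
    and differentiable_metric: "x \<in> S \<Longrightarrow> (\<lambda>x. G x $ i $ j) differentiable (at x)"
    and differentiable_pdiff_metric: "x \<in> S \<Longrightarrow> pdiff l (\<lambda>x. G x $ i $ j) differentiable (at x)"
    and metric_commute: "x \<in> S \<Longrightarrow> G x $ i $ j = G x $ j $ i"
    and coord_inner_pos: "x \<in> S \<Longrightarrow> v \<noteq> 0 \<Longrightarrow> coord_inner G x v v > 0"
begin

lemma metric_ker: "x \<in> S \<Longrightarrow> G x *v v = 0 \<Longrightarrow> v = 0"
proof (rule ccontr)
  assume x: "x \<in> S" and 0: "G x *v v = 0" and "v \<noteq> 0"
  have "coord_inner G x v v = (\<Sum>i\<in>UNIV. v $ i * (G x *v v) $ i)"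
    by (simp add: coord_inner_def matrix_vector_mult_def sum_distrib_left mult_ac)
  then show False
    using coord_inner_pos[OF x \<open>v \<noteq> 0\<close>] 0 by simp
qed

lemma metric_inj: "x \<in> S \<Longrightarrow> G x *v v = G x *v w \<Longrightarrow> v = w"
  using metric_ker[of x "v - w"] by (simp add: matrix_vector_mult_diff_distrib)

lemma invertible_metric: "x \<in> S \<Longrightarrow> invertible (G x)"
  using metric_ker by (simp add: invertible_left_inverse matrix_left_invertible_ker)

lemma differentiable_metric_inv: "x \<in> S \<Longrightarrow> (\<lambda>x. matrix_inv (G x) $ k $ l) differentiable (at x)"
  using open_S invertible_metric by (intro differentiable_matrix_inv[of G x S]) (auto intro: differentiable_metric)

lemma pdiff_metric_commute: "x \<in> S \<Longrightarrow> pdiff l (\<lambda>x. G x $ i $ j) x = pdiff l (\<lambda>x. G x $ j $ i) x"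
  by (rule pdiff_cong[OF open_S]) (auto intro: metric_commute)

text \<open>Raising an index and lowering it again; this clears inverse matrices from gradients and
  Christoffel symbols.\<close>

lemma metric_mult_inv:
  assumes "x \<in> S"
  shows "(\<Sum>k\<in>UNIV. G x $ a $ k * (\<Sum>l\<in>UNIV. matrix_inv (G x) $ k $ l * c l)) = c a"
proof -
  have "G x *v (matrix_inv (G x) *v (\<chi> l. c l)) = (\<chi> l. c l)"
    using matrix_inv(1)[OF invertible_metric[OF assms]] by (simp add: matrix_vector_mul_assoc)
  from this[THEN arg_cong[where f="\<lambda>v. v $ a"]] show ?thesis
    by (simp add: matrix_vector_mult_def)
qed

text \<open>The right-hand side is the Christoffel symbol of the first kind.\<close>

lemma christoffel_lower:
  assumes "x \<in> S"
  shows "(\<Sum>k\<in>UNIV. G x $ a $ k * christoffel G k i j x) =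
    (1/2) * (pdiff i (\<lambda>y. G y $ j $ a) x + pdiff j (\<lambda>y. G y $ i $ a) x - pdiff a (\<lambda>y. G y $ i $ j) x)"
  using metric_mult_inv[OF assms, of a "\<lambda>l. (1/2) *
     (pdiff i (\<lambda>y. G y $ j $ l) x + pdiff j (\<lambda>y. G y $ i $ l) x - pdiff l (\<lambda>y. G y $ i $ j) x)"]
  by (simp only: christoffel_def sum_distrib_left mult.left_commute)

lemma christoffel_commute: "x \<in> S \<Longrightarrow> christoffel G k i j x = christoffel G k j i x"
  unfolding christoffel_def by (simp add: pdiff_metric_commute[of x _ i j] add.commute)

lemma differentiable_christoffel: "x \<in> S \<Longrightarrow> christoffel G k i j differentiable (at x)"
  unfolding christoffel_def[abs_def]
  by (intro differentiable_mult differentiable_const differentiable_sum ballI differentiable_add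
      differentiable_diff differentiable_metric_inv differentiable_pdiff_metric finite)

end

locale conformal_chart = metric_chart S G
  for S :: "(real^'n::finite) set" and G :: "real^'n \<Rightarrow> real^'n^'n" +
  fixes U \<psi> :: "real^'n \<Rightarrow> real"
  assumes differentiable_U: "x \<in> S \<Longrightarrow> U differentiable (at x)"
    and differentiable_pdiff_U: "x \<in> S \<Longrightarrow> pdiff i U differentiable (at x)"
    and differentiable_\<psi>: "x \<in> S \<Longrightarrow> \<psi> differentiable (at x)"
    and hessian_U: "x \<in> S \<Longrightarrow> coord_hessian G U x i j = \<psi> x * G x $ i $ j"
begin

abbreviation X :: "real^'n \<Rightarrow> real^'n" where
  "X \<equiv> coord_gradient G U"

lemma pdiff_U: "x \<in> S \<Longrightarrow> pdiff j U x = (\<Sum>l\<in>UNIV. G x $ j $ l * X x $ l)"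
  using metric_mult_inv[of x j "\<lambda>l. pdiff l U x"] by (simp add: coord_gradient_def)

lemma differentiable_X: "x \<in> S \<Longrightarrow> (\<lambda>x. X x $ l) differentiable (at x)"
  unfolding coord_gradient_def
  by (simp, intro differentiable_sum ballI differentiable_mult differentiable_metric_inv
      differentiable_pdiff_U finite)

text \<open>Differentiating \<open>pdiff_U\<close> and inserting the Hessian equation gives this
  identity with the index \<open>l\<close> lowered; injectivity of the metric then removes
  \<open>G x\<close>. In invariant terms, the covariant derivative of \<open>X\<close> in any
  direction is \<open>\<psi>\<close> times that direction.\<close>

lemma pdiff_X:
  assumes x: "x \<in> S"
  shows "pdiff i (\<lambda>x. X x $ l) x =
    \<psi> x * (if i = l then 1 else 0) - (\<Sum>k\<in>UNIV. christoffel G l i k x * X x $ k)"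
proof -
  define C where "C a i j = (1/2) *
    (pdiff i (\<lambda>y. G y $ j $ a) x + pdiff j (\<lambda>y. G y $ i $ a) x - pdiff a (\<lambda>y. G y $ i $ j) x)" for a i j
  define Z where "Z = (\<chi> l. \<psi> x * (if i = l then 1 else 0) - (\<Sum>k\<in>UNIV. christoffel G l i k x * X x $ k))"
  have "G x *v (\<chi> l. pdiff i (\<lambda>x. X x $ l) x) = G x *v Z"
  proof (subst vec_eq_iff, intro allI)
    fix j
    have "pdiff i (pdiff j U) x = pdiff i (\<lambda>x. \<Sum>l\<in>UNIV. G x $ j $ l * X x $ l) x"
      by (rule pdiff_cong[OF open_S x pdiff_U])
    also have "\<dots> = (\<Sum>l\<in>UNIV. pdiff i (\<lambda>x. G x $ j $ l) x * X x $ l + G x $ j $ l * pdiff i (\<lambda>x. X x $ l) x)"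
      using x by (simp add: pdiff_sum pdiff_mult differentiable_mult differentiable_metric differentiable_X)
    finally have 1: "pdiff i (pdiff j U) x =
      (\<Sum>l\<in>UNIV. pdiff i (\<lambda>x. G x $ j $ l) x * X x $ l) + (\<Sum>l\<in>UNIV. G x $ j $ l * pdiff i (\<lambda>x. X x $ l) x)"
      by (simp add: sum.distrib)
    have "(\<Sum>k\<in>UNIV. christoffel G k i j x * pdiff k U x) =
        (\<Sum>k\<in>UNIV. \<Sum>l\<in>UNIV. G x $ l $ k * christoffel G k i j x * X x $ l)"
      using x by (simp add: pdiff_U sum_distrib_left metric_commute[of x _ "_::'n"] mult_ac cong: sum.cong)
    also have "\<dots> = (\<Sum>l\<in>UNIV. C l i j * X x $ l)"
      by (subst sum.swap) (simp add: christoffel_lower[OF x, folded C_def] flip: sum_distrib_right)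
    finally have 2: "(\<Sum>k\<in>UNIV. christoffel G k i j x * pdiff k U x) = (\<Sum>l\<in>UNIV. C l i j * X x $ l)" .
    have "(\<Sum>l\<in>UNIV. \<Sum>k\<in>UNIV. G x $ j $ l * (christoffel G l i k x * X x $ k)) = (\<Sum>k\<in>UNIV. C j i k * X x $ k)"
      by (subst sum.swap) (simp add: christoffel_lower[OF x, folded C_def] flip: sum_distrib_right mult.assoc)
    then have "(G x *v Z) $ j = \<psi> x * G x $ i $ j - (\<Sum>k\<in>UNIV. C j i k * X x $ k)"
      using metric_commute[OF x]
      by (simp add: Z_def matrix_vector_mult_def right_diff_distrib sum_subtractf sum_distrib_left
          if_distrib[where f="\<lambda>r. _ * r"] mult_ac cong: if_cong)
    also have "\<dots> = \<psi> x * G x $ i $ j + (\<Sum>k\<in>UNIV. C k i j * X x $ k) - (\<Sum>l\<in>UNIV. pdiff i (\<lambda>x. G x $ j $ l) x * X x $ l)"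
    proof -
      \<comment> \<open>Metric compatibility: the derivative of \<open>G x $ j $ k\<close> in
        direction \<open>i\<close> is the sum of the first-kind symbols \<open>C k i j\<close> and
        \<open>C j i k\<close>.\<close>
      have "C k i j - pdiff i (\<lambda>x. G x $ j $ k) x = - C j i k" for k
        using pdiff_metric_commute[OF x, of i j k] pdiff_metric_commute[OF x, of k i j]
        by (simp add: C_def field_simps)
      then have "(\<Sum>k\<in>UNIV. (C k i j - pdiff i (\<lambda>x. G x $ j $ k) x) * X x $ k) = - (\<Sum>k\<in>UNIV. C j i k * X x $ k)"
        by (simp add: sum_negf)
      then show ?thesis
        by (simp add: left_diff_distrib sum_subtractf)
    qed
    also have "\<dots> = (\<Sum>l\<in>UNIV. G x $ j $ l * pdiff i (\<lambda>x. X x $ l) x)"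
      using hessian_U[OF x, of i j] 1 2 by (simp add: coord_hessian_def)
    finally show "(G x *v (\<chi> l. pdiff i (\<lambda>x. X x $ l) x)) $ j = (G x *v Z) $ j"
      by (simp add: matrix_vector_mult_def)
  qed
  from metric_inj[OF x this] show ?thesis
    by (simp add: Z_def vec_eq_iff)
qed

text \<open>The Hessian equation gains a derivative: the right-hand side of \<open>pdiff_X\<close>
  contains no derivative of \<open>X\<close>, so the second partials needed for commuting
  derivatives exist although \<open>U\<close> is only assumed to be twice differentiable.\<close>

lemma differentiable_pdiff_X: "x \<in> S \<Longrightarrow> pdiff i (\<lambda>x. X x $ l) differentiable (at x)"
proof -
  assume x: "x \<in> S"
  have "(\<lambda>x. \<psi> x * (if i = l then 1 else 0) - (\<Sum>k\<in>UNIV. christoffel G l i k x * X x $ k)) differentiable (at x)"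
    using x by (intro differentiable_diff differentiable_mult differentiable_sum ballI finite differentiable_const
        differentiable_\<psi> differentiable_christoffel differentiable_X)
  then obtain D where "((\<lambda>x. \<psi> x * (if i = l then 1 else 0) - (\<Sum>k\<in>UNIV. christoffel G l i k x * X x $ k)) has_derivative D) (at x)"
    unfolding differentiable_def by blast
  from has_derivative_transform_within_open[OF this open_S x pdiff_X[symmetric]] show ?thesis
    by (rule differentiableI)
qed

section \<open>Curvature and energy of a conformal gradient field\<close>

text \<open>Symmetry of the second partials of \<open>X\<close>, with \<open>pdiff_X\<close>
  substituted twice: products and derivatives of Christoffel symbols assemble to the curvature, the
  terms with \<open>\<psi>\<close> times a symbol cancel by symmetry in \<open>i\<close> and
  \<open>j\<close>, and the derivatives of \<open>\<psi>\<close> remain.\<close>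

lemma riemann_X:
  assumes x: "x \<in> S"
  shows "(\<Sum>k\<in>UNIV. riemann G l k i j x * X x $ k) =
    pdiff i \<psi> x * (if j = l then 1 else 0) - pdiff j \<psi> x * (if i = l then 1 else 0)"
proof -
  define A where "A j i = pdiff j \<psi> x * (if i = l then 1 else 0)
      - (\<Sum>k\<in>UNIV. pdiff j (christoffel G l i k) x * X x $ k) - \<psi> x * christoffel G l i j x
      + (\<Sum>m\<in>UNIV. \<Sum>k\<in>UNIV. christoffel G l i m x * christoffel G m j k x * X x $ k)" for i j
  have A: "pdiff j (pdiff i (\<lambda>x. X x $ l)) x = A j i" for i j
  proof -
    have "pdiff j (pdiff i (\<lambda>x. X x $ l)) x =
      pdiff j (\<lambda>x. \<psi> x * (if i = l then 1 else 0) - (\<Sum>k\<in>UNIV. christoffel G l i k x * X x $ k)) x"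
      by (rule pdiff_cong[OF open_S x pdiff_X])
    also have "\<dots> = pdiff j \<psi> x * (if i = l then 1 else 0)
        - (\<Sum>k\<in>UNIV. pdiff j (christoffel G l i k) x * X x $ k + christoffel G l i k x * pdiff j (\<lambda>x. X x $ k) x)"
      using x by (subst pdiff_diff) (auto intro!: differentiable_mult differentiable_sum
          simp: pdiff_sum pdiff_mult pdiff_const differentiable_mult differentiable_christoffel differentiable_X differentiable_\<psi>)
    also have "\<dots> = A j i"
      by (simp add: A_def pdiff_X[OF x] sum.distrib right_diff_distrib sum_subtractf sum_distrib_left
          if_distrib[where f="\<lambda>r. _ * r"] mult_ac cong: if_cong)
    finally show ?thesis .
  qed
  have "A j i = A i j"
    unfolding A[symmetric] using x
    by (intro pdiff_commute[OF open_S] differentiable_X differentiable_pdiff_X)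
  moreover have "(\<Sum>k\<in>UNIV. (\<Sum>m\<in>UNIV. christoffel G l i m x * christoffel G m j k x) * X x $ k)
      = (\<Sum>m\<in>UNIV. \<Sum>k\<in>UNIV. christoffel G l i m x * christoffel G m j k x * X x $ k)" for i j
    by (subst sum.swap) (simp add: sum_distrib_right)
  ultimately show ?thesis
    by (simp add: A_def riemann_def algebra_simps sum.distrib sum_subtractf christoffel_commute[OF x, of l i j])
qed

text \<open>In the trace of \<open>riemann_X\<close> over \<open>l = i\<close> the first delta
  leaves one copy of the differential of \<open>\<psi>\<close>, while the second is summed to the
  dimension.\<close>

lemma Ric_X:
  assumes x: "x \<in> S"
  shows "coord_Ric G x (X x) (X x) = - (real CARD('n) - 1) * (\<Sum>j\<in>UNIV. X x $ j * pdiff j \<psi> x)"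
proof -
  have "coord_Ric G x (X x) (X x) = (\<Sum>j\<in>UNIV. X x $ j * (\<Sum>k\<in>UNIV. \<Sum>i\<in>UNIV. riemann G i k i j x * X x $ k))"
    by (simp add: coord_Ric_def sum_distrib_left sum_distrib_right mult_ac)
  also have "\<dots> = (\<Sum>j\<in>UNIV. X x $ j * (\<Sum>i\<in>UNIV. \<Sum>k\<in>UNIV. riemann G i k i j x * X x $ k))"
    by (subst (2) sum.swap) simp
  also have "\<dots> = (\<Sum>j\<in>UNIV. X x $ j * (pdiff j \<psi> x - real CARD('n) * pdiff j \<psi> x))"
    by (simp add: riemann_X[OF x] sum_subtractf if_distrib[where f="\<lambda>r. _ * r"] cong: if_cong)
  also have "\<dots> = - (real CARD('n) - 1) * (\<Sum>j\<in>UNIV. X x $ j * pdiff j \<psi> x)"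
    by (simp add: sum_distrib_left algebra_simps)
  finally show ?thesis .
qed

lemma energy_eq: "x \<in> S \<Longrightarrow> coord_inner G x (X x) (X x) = (\<Sum>j\<in>UNIV. X x $ j * pdiff j U x)"
  by (simp add: coord_inner_def pdiff_U sum_distrib_left mult_ac)

lemma differentiable_energy:
  assumes x: "x \<in> S"
  shows "(\<lambda>x. coord_inner G x (X x) (X x)) differentiable (at x)"
  unfolding coord_inner_def using x
  by (intro differentiable_sum ballI finite differentiable_mult differentiable_metric differentiable_X)

text \<open>The energy is the pairing of \<open>X\<close> with the partials of \<open>U\<close>. The
  product rule yields one term \<open>\<psi> x * pdiff i U x\<close> from each factor, and the
  Christoffel terms of the two factors cancel.\<close>

lemma pdiff_energy:
  assumes x: "x \<in> S"
  shows "pdiff i (\<lambda>x. coord_inner G x (X x) (X x)) x = 2 * \<psi> x * pdiff i U x"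
proof -
  have "pdiff i (\<lambda>x. coord_inner G x (X x) (X x)) x = pdiff i (\<lambda>x. \<Sum>j\<in>UNIV. X x $ j * pdiff j U x) x"
    by (rule pdiff_cong[OF open_S x energy_eq])
  also have "\<dots> = (\<Sum>j\<in>UNIV. pdiff i (\<lambda>x. X x $ j) x * pdiff j U x) + (\<Sum>j\<in>UNIV. X x $ j * pdiff i (pdiff j U) x)"
    using x by (simp add: pdiff_sum pdiff_mult differentiable_mult differentiable_X differentiable_pdiff_U sum.distrib)
  also have "(\<Sum>j\<in>UNIV. pdiff i (\<lambda>x. X x $ j) x * pdiff j U x) =
      \<psi> x * pdiff i U x - (\<Sum>j\<in>UNIV. \<Sum>k\<in>UNIV. X x $ j * (christoffel G k i j x * pdiff k U x))"
  proof -
    have "(\<Sum>j\<in>UNIV. pdiff i (\<lambda>x. X x $ j) x * pdiff j U x) =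
      (\<Sum>j\<in>UNIV. \<psi> x * (if i = j then 1 else 0) * pdiff j U x)
        - (\<Sum>j\<in>UNIV. \<Sum>k\<in>UNIV. christoffel G j i k x * X x $ k * pdiff j U x)"
      by (simp only: pdiff_X[OF x] left_diff_distrib sum_subtractf sum_distrib_right)
    also have "(\<Sum>j\<in>UNIV. \<psi> x * (if i = j then 1 else 0) * pdiff j U x) = \<psi> x * pdiff i U x"
      by (simp add: if_distrib[where f="\<lambda>r. _ * r"] if_distrib[where f="\<lambda>r. r * _"] cong: if_cong)
    also have "(\<Sum>j\<in>UNIV. \<Sum>k\<in>UNIV. christoffel G j i k x * X x $ k * pdiff j U x)
        = (\<Sum>j\<in>UNIV. \<Sum>k\<in>UNIV. X x $ j * (christoffel G k i j x * pdiff k U x))"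
      by (subst sum.swap) (simp add: mult_ac)
    finally show ?thesis .
  qed
  also have "(\<Sum>j\<in>UNIV. X x $ j * pdiff i (pdiff j U) x) =
      \<psi> x * pdiff i U x + (\<Sum>j\<in>UNIV. \<Sum>k\<in>UNIV. X x $ j * (christoffel G k i j x * pdiff k U x))"
  proof -
    have "pdiff i (pdiff j U) x = \<psi> x * G x $ i $ j + (\<Sum>k\<in>UNIV. christoffel G k i j x * pdiff k U x)" for j
      using hessian_U[OF x, of i j] by (simp add: coord_hessian_def)
    then show ?thesis
      by (simp add: pdiff_U[OF x, of i] sum_distrib_left algebra_simps sum.distrib)
  qed
  finally show ?thesis by simp
qed

text \<open>The function \<open>a\<close> in the proof is the factor in \<open>dw = a dU\<close>; it vanishes at \<open>x\<close> and increases along \<open>X x\<close>.\<close>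

lemma energy_no_local_max:
  assumes x: "x \<in> S" and ric: "coord_Ric G x (X x) (X x) \<le> 0" and n: "CARD('n) \<ge> 2"
    and e: "e > 0" and pos: "coord_inner G x (X x) (X x) > 0"
    and max: "\<And>y. y \<in> S \<Longrightarrow> coord_inner G y (X y) (X y) + e * exp (- U y)
      \<le> coord_inner G x (X x) (X x) + e * exp (- U x)"
  shows False
proof -
  define w where "w y = coord_inner G y (X y) (X y) + e * exp (- U y)" for y
  define a where "a y = 2 * \<psi> y - e * exp (- U y)" for y
  let ?v = "X x"
  have dmU: "(\<lambda>y. - U y) differentiable (at y)" "(\<lambda>y. exp (- U y)) differentiable (at y)" if "y \<in> S" for y
    using differentiable_U[OF that] by (auto intro!: differentiable_exp)
  have pexp: "pdiff i (\<lambda>y. e * exp (- U y)) y = - (e * exp (- U y) * pdiff i U y)" if "y \<in> S" for i y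
    using dmU[OF that] pdiff_cmult[OF differentiable_U[OF that], of i "-1"]
    by (simp add: pdiff_cmult pdiff_exp)
  have dw: "w differentiable (at y)" if "y \<in> S" for y
    unfolding w_def[abs_def] using that by (intro differentiable_add differentiable_energy differentiable_mult differentiable_const dmU)
  have pw: "pdiff i w y = a y * pdiff i U y" if "y \<in> S" for i y
    unfolding w_def[abs_def]
    by (subst pdiff_add) (use that dmU in \<open>auto intro: differentiable_energy differentiable_mult simp: pdiff_energy pexp a_def left_diff_distrib\<close>)
  have da: "a differentiable (at y)" if "y \<in> S" for y
    unfolding a_def[abs_def] using that by (intro differentiable_diff differentiable_mult differentiable_const dmU differentiable_\<psi>)
  have pa: "pdiff i a x = 2 * pdiff i \<psi> x + e * exp (- U x) * pdiff i U x" for i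
    unfolding a_def[abs_def] using x dmU
    by (subst pdiff_diff) (auto intro: differentiable_mult differentiable_\<psi> simp: pexp pdiff_cmult[OF differentiable_\<psi>])
  \<comment> \<open>The direction is frozen at \<open>X x\<close>, so a straight coordinate line
    serves instead of an integral curve of \<open>X\<close>; \<open>b\<close> is the derivative of
    \<open>U\<close> in this direction and stays positive near \<open>x\<close>.\<close>
  define b where "b y = (\<Sum>i\<in>UNIV. ?v $ i * pdiff i U y)" for y
  have bpos: "b x > 0"
    using pos energy_eq[OF x] by (simp add: b_def)
  \<comment> \<open>Here \<open>CARD('n) \<ge> 2\<close> makes the factor in \<open>Ric_X\<close>
    negative, so the sign of the Ricci term is reversed.\<close>
  have d\<psi>: "(\<Sum>i\<in>UNIV. ?v $ i * pdiff i \<psi> x) \<ge> 0"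
    using ric n unfolding Ric_X[OF x] by (simp add: mult_le_0_iff zero_le_mult_iff)
  have apos: "(\<Sum>i\<in>UNIV. ?v $ i * pdiff i a x) > 0"
  proof -
    have "(\<Sum>i\<in>UNIV. ?v $ i * pdiff i a x) = 2 * (\<Sum>i\<in>UNIV. ?v $ i * pdiff i \<psi> x) + e * exp (- U x) * b x"
      by (simp add: pa b_def algebra_simps sum.distrib sum_distrib_left)
    moreover have "e * exp (- U x) * b x > 0" using e bpos by simp
    ultimately show ?thesis using d\<psi> by linarith
  qed
  define l where "l t = x + t *\<^sub>R ?v" for t :: real
  have l0: "l 0 = x" by (simp add: l_def)
  have "isCont l 0" unfolding l_def by (intro continuous_intros)
  then have lim: "(l \<longlongrightarrow> l 0) (nhds 0)"
    by (simp add: isCont_def tendsto_at_iff_tendsto_nhds)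
  have "\<forall>\<^sub>F t in nhds 0. l t \<in> S"
    using topological_tendstoD[OF lim open_S] x by (simp add: l0)
  moreover have "\<forall>\<^sub>F t in nhds 0. b (l t) > 0"
  proof -
    have "b differentiable (at x)"
      unfolding b_def[abs_def] using x by (intro differentiable_sum ballI finite differentiable_mult differentiable_const differentiable_pdiff_U)
    then have "isCont b (l 0)"
      by (simp add: l0 differentiable_imp_continuous_within)
    from order_tendstoD(1)[OF isCont_tendsto_compose[OF this lim]] show ?thesis
      using bpos by (simp add: l0)
  qed
  ultimately have "\<forall>\<^sub>F t in nhds 0. l t \<in> S \<and> b (l t) > 0"
    by (rule eventually_conj)
  then obtain d where d: "d > 0" "\<And>t. \<bar>t\<bar> < d \<Longrightarrow> l t \<in> S \<and> b (l t) > 0"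
    unfolding eventually_nhds_metric by (auto simp: dist_real_def)
  have kd: "((\<lambda>t. w (l t)) has_real_derivative a (l t) * b (l t)) (at t)" if "\<bar>t\<bar> < d" for t
  proof -
    have lS: "l t \<in> S" using d that by auto
    have "((\<lambda>t. w (l t)) has_real_derivative (\<Sum>i\<in>UNIV. ?v $ i * pdiff i w (l t))) (at t)"
      using has_derivative_line[of w x t ?v] dw[OF lS] by (simp add: l_def)
    then show ?thesis
      by (simp add: pw[OF lS] b_def sum_distrib_left mult_ac)
  qed
  have "a (l 0) * b (l 0) = 0"
    using DERIV_local_max[OF kd[of 0] d(1)] d max by (auto simp: w_def l0)
  then have a0: "a (l 0) = 0" using bpos by (auto simp: l0)
  have "((\<lambda>t. a (l t)) has_real_derivative (\<Sum>i\<in>UNIV. ?v $ i * pdiff i a x)) (at 0)"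
    using has_derivative_line[of a x 0 ?v] da[OF x] by (simp add: l_def)
  from DERIV_pos_inc_right[OF this apos] obtain d' where d': "d' > 0" "\<And>t. 0 < t \<Longrightarrow> t < d' \<Longrightarrow> a (l t) > 0"
    using a0 by auto
  define t where "t = min d d' / 2"
  have t: "0 < t" "t < d" "t < d'" using d(1) d'(1) by (auto simp: t_def)
  \<comment> \<open>In place of a second derivative test: \<open>a\<close> and \<open>b\<close> are
    both positive on the line for small positive parameters, so by the mean value theorem
    \<open>w\<close> grows strictly beyond its value at \<open>x\<close>.\<close>
  have "\<exists>z. 0 < z \<and> z < t \<and> w (l t) - w (l 0) = (t - 0) * (a (l z) * b (l z))"
    using t by (intro MVT2) (auto intro!: kd)
  then obtain z where z: "0 < z" "z < t" "w (l t) - w (l 0) = t * (a (l z) * b (l z))"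
    by auto
  have "t * (a (l z) * b (l z)) > 0"
    using z t d(2)[of z] d'(2)[of z] by simp
  then have "w (l t) > w (l 0)"
    using z by linarith
  then show False
    using max[of "l t"] d(2)[of t] t by (simp add: w_def l0)
qed

end

section \<open>Compactness of closed balls in complete length spaces\<close>

text \<open>The Hopf--Rinow theorem in Cohn-Vossen's form: the supremum of the radii of compact balls about
  \<open>x0\<close> is attained by completeness, and could then be enlarged by local compactness.\<close>

lemma (in Metric_space) compactin_mcball_length_space:
  assumes "mcomplete" and "x0 \<in> M"
    and loc: "\<And>x. x \<in> M \<Longrightarrow> \<exists>r>0. compactin mtopology (mcball x r)"
    and split: "\<And>x y s t. x \<in> M \<Longrightarrow> y \<in> M \<Longrightarrow> 0 < s \<Longrightarrow> 0 < t \<Longrightarrow> d x y < s + t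
      \<Longrightarrow> \<exists>z\<in>M. d x z < s \<and> d z y < t"
  shows "compactin mtopology (mcball x0 r)"
proof (rule ccontr)
  let ?P = "\<lambda>r. compactin mtopology (mcball x0 r)"
  assume r: "\<not> ?P r"
  have mono: "?P s" if "?P r" "s \<le> r" for r s
    using closed_compactin[OF that(1) mcball_subset_concentric[OF that(2)] closedin_mcball] .
  obtain r0 where r0: "r0 > 0" "?P r0" using loc[OF \<open>x0 \<in> M\<close>] by blast
  have bdd: "bdd_above {s. ?P s}"
  proof (rule bdd_aboveI)
    show "s \<le> r" if "s \<in> {s. ?P s}" for s
      using that mono[of s r] r by (cases "r \<le> s") auto
  qed
  define R where "R = Sup {s. ?P s}"
  have "r0 \<le> R" unfolding R_def using bdd r0 by (intro cSup_upper) auto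
  then have R: "R > 0" using r0 by simp
  have below: "?P s" if "s < R" for s
  proof -
    have "\<exists>s'\<in>{s. ?P s}. s < s'"
      using that r0 unfolding R_def by (intro less_cSupD) auto
    then obtain s' where "?P s'" "s < s'" by blast
    then show ?thesis using mono[of s' s] by simp
  qed
  \<comment> \<open>Splitting puts each point of this ball within \<open>e / 2\<close> of a slightly
    smaller ball, which is compact by \<open>below\<close>; completeness then turns total
    boundedness into compactness.\<close>
  have "mtotally_bounded (mcball x0 R)"
    unfolding mtotally_bounded_def
  proof (intro allI impI)
    fix e :: real assume e: "e > 0"
    \<comment> \<open>Less than \<open>R\<close>, so that \<open>below\<close> applies, while
      \<open>s + e / 2\<close> strictly exceeds \<open>R\<close>, as \<open>split\<close> demands;
      \<open>R / 2\<close> keeps \<open>s\<close> positive.\<close>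
    define s where "s = max (R / 2) (R - e / 4)"
    have s: "0 < s" "s < R" "R < s + e / 2" using R e by (auto simp: s_def)
    have "mtotally_bounded (mcball x0 s)"
      using below[OF s(2)] by (rule compactin_imp_mtotally_bounded)
    then obtain K where K: "finite K" "K \<subseteq> mcball x0 s" "mcball x0 s \<subseteq> (\<Union>x\<in>K. mball x (e / 2))"
      using e unfolding mtotally_bounded_def by (meson half_gt_zero)
    have "mcball x0 R \<subseteq> (\<Union>x\<in>K. mball x e)"
    proof
      fix y assume y: "y \<in> mcball x0 R"
      then obtain z where z: "z \<in> M" "d x0 z < s" "d z y < e / 2"
        using split[of x0 y s "e / 2"] s e by auto
      then obtain k where k: "k \<in> K" "z \<in> mball k (e / 2)"
        using K(3) \<open>x0 \<in> M\<close> by force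
      then have "d k y < e"
        using triangle[of k z y] z y by auto
      then show "y \<in> (\<Union>x\<in>K. mball x e)"
        using k y by auto
    qed
    moreover have "K \<subseteq> mcball x0 R" using K(2) s(2) by fastforce
    ultimately show "\<exists>K. finite K \<and> K \<subseteq> mcball x0 R \<and> mcball x0 R \<subseteq> (\<Union>x\<in>K. mball x e)"
      using K(1) by blast
  qed
  then have PR: "?P R"
    using mtotally_bounded_eq_compact_closure_of[OF \<open>mcomplete\<close>] by (metis closedin_mcball closure_of_closedin)
  \<comment> \<open>Balls of half the radius cover, so the full radii leave a margin of at least
    \<open>e\<close>, and a finite compact union contains a ball of radius larger than
    \<open>R\<close>.\<close>
  obtain \<rho> where \<rho>: "\<And>x. x \<in> M \<Longrightarrow> \<rho> x > 0 \<and> compactin mtopology (mcball x (\<rho> x))"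
    using loc by metis
  have "\<exists>F. finite F \<and> F \<subseteq> (\<lambda>x. mball x (\<rho> x / 2)) ` mcball x0 R \<and> mcball x0 R \<subseteq> \<Union>F"
    using \<rho> by (intro compactinD[OF PR]) auto
  then obtain K where K: "finite K" "K \<subseteq> mcball x0 R" "mcball x0 R \<subseteq> (\<Union>x\<in>K. mball x (\<rho> x / 2))"
    by (metis (no_types, lifting) finite_subset_image)
  have KM: "K \<subseteq> M" using K(2) by auto
  have "K \<noteq> {}" using K(3) \<open>x0 \<in> M\<close> R centre_in_mcball_iff[of x0 R] by fastforce
  define e where "e = Min (\<rho> ` K) / 2"
  have e: "e > 0" using K(1) \<open>K \<noteq> {}\<close> \<rho> KM by (auto simp: e_def subset_eq)
  have eK: "e \<le> \<rho> k / 2" if "k \<in> K" for k using K(1) that by (simp add: e_def)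
  have "mcball x0 (R + e / 2) \<subseteq> (\<Union>x\<in>K. mcball x (\<rho> x))"
  proof
    fix y assume y: "y \<in> mcball x0 (R + e / 2)"
    then obtain z where z: "z \<in> M" "d x0 z < R" "d z y < e"
      using split[of x0 y R e] R e by auto
    then obtain k where k: "k \<in> K" "z \<in> mball k (\<rho> k / 2)"
      using K(3) \<open>x0 \<in> M\<close> by force
    then have "d k y \<le> \<rho> k"
      using triangle[of k z y] z y eK[OF k(1)] by auto
    then show "y \<in> (\<Union>x\<in>K. mcball x (\<rho> x))"
      using k y by auto
  qed
  moreover have "compactin mtopology (\<Union>x\<in>K. mcball x (\<rho> x))"
    using K(1) KM \<rho> by (intro compactin_Union) auto
  ultimately have "?P (R + e / 2)"
    using closed_compactin by blast
  then have "R + e / 2 \<le> R"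
    unfolding R_def using bdd by (intro cSup_upper) auto
  then show False using e by simp
qed

section \<open>Charts and metric norms\<close>

lemma smooth_on_imp_differentiable:
  assumes "smooth_on S F" "open S" "x \<in> S"
  shows "F differentiable (at x)" "pdiff i F differentiable (at x)"
proof -
  have "Ck_on (Suc (Suc 0)) S F"
    using assms(1) by (simp add: smooth_on_def)
  then show "F differentiable (at x)" "pdiff i F differentiable (at x)"
    using assms(2,3) by (auto simp: differentiable_on_eq_differentiable_at)
qed

lemma smooth_on_imp_continuous_on:
  assumes "smooth_on S F"
  shows "continuous_on S F" "continuous_on S (pdiff i F)"
proof -
  have "Ck_on 0 S F" "Ck_on (Suc 0) S F"
    using assms by (auto simp: smooth_on_def simp del: Ck_on.simps)
  then show "continuous_on S F" "continuous_on S (pdiff i F)"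
    by auto
qed

lemma coord_inner_eq: "coord_inner G x v w = v \<bullet> (G x *v w)"
  by (simp add: coord_inner_def inner_vec_def matrix_vector_mult_def sum_distrib_left mult_ac)

lemma coord_norm_scaleR: "coord_norm G x (a *\<^sub>R v) = \<bar>a\<bar> * coord_norm G x v"
  by (simp add: coord_norm_def coord_inner_eq matrix_vector_mult_scaleR real_sqrt_mult flip: mult.assoc)

lemma continuous_on_coord_norm:
  assumes "continuous_on S G" "continuous_on T f" "continuous_on T v" "f ` T \<subseteq> S"
  shows "continuous_on T (\<lambda>t. coord_norm G (f t) (v t))"
proof -
  have "continuous_on T (\<lambda>t. G (f t))"
    using continuous_on_compose2[OF assms(1,2,4)] .
  then show ?thesis
    unfolding coord_norm_def coord_inner_def using assms(3)
    by (intro continuous_intros) auto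
qed

section \<open>Change of coordinates between charts\<close>

context smooth_manifold begin

lemma open_chart_dom: "c \<in> A \<Longrightarrow> open (chart_dom c)"
  and open_chart_image: "c \<in> A \<Longrightarrow> open (chart_image c)"
  and continuous_on_coord: "c \<in> A \<Longrightarrow> continuous_on (chart_dom c) (coord c)"
  and continuous_on_param: "c \<in> A \<Longrightarrow> continuous_on (chart_image c) (param c)"
  and param_coord: "c \<in> A \<Longrightarrow> p \<in> chart_dom c \<Longrightarrow> param c (coord c p) = p"
  and coord_param: "c \<in> A \<Longrightarrow> x \<in> chart_image c \<Longrightarrow> coord c (param c x) = x"
  using charts[of c] by (auto simp: is_chart_def homeomorphism_def)

lemma coord_in_image: "p \<in> chart_dom c \<Longrightarrow> coord c p \<in> chart_image c"
  by (simp add: chart_image_def)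

lemma param_in_dom: "x \<in> chart_image c \<Longrightarrow> param c x \<in> chart_dom c"
  by (simp add: chart_image_def param_def inv_into_into)

lemma chart_at: "chart_at A p \<in> A" "p \<in> chart_dom (chart_at A p)"
proof -
  have "p \<in> (\<Union>c\<in>A. chart_dom c)"
    by (simp add: covering)
  then have "\<exists>c. c \<in> A \<and> p \<in> chart_dom c"
    by blast
  from someI_ex[OF this] show "chart_at A p \<in> A" "p \<in> chart_dom (chart_at A p)"
    by (auto simp: chart_at_def)
qed

lemma open_param_image:
  assumes c: "c \<in> A" and B: "open B" "B \<subseteq> chart_image c"
  shows "open (param c ` B)"
proof -
  have "param c ` B = coord c -` B \<inter> chart_dom c"
    using B(2) c by (force simp: coord_param param_coord param_in_dom image_iff)
  then show ?thesis
    using continuous_open_preimage[OF continuous_on_coord[OF c] open_chart_dom[OF c] B(1)]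
    by (simp add: Int_commute)
qed

lemma open_coord_image:
  assumes c: "c \<in> A" and U: "open U" "U \<subseteq> chart_dom c"
  shows "open (coord c ` U)"
proof -
  have "coord c ` U = param c -` U \<inter> chart_image c"
    using U(2) c by (force simp: coord_param param_coord coord_in_image image_iff)
  then show ?thesis
    using continuous_open_preimage[OF continuous_on_param[OF c] open_chart_image[OF c] U(1)]
    by (simp add: Int_commute)
qed

lemma open_overlap: "c \<in> A \<Longrightarrow> d \<in> A \<Longrightarrow> open (coord c ` (chart_dom c \<inter> chart_dom d))"
  by (intro open_coord_image open_Int open_chart_dom) auto

lemma transition_differentiable:
  assumes "c \<in> A" "d \<in> A" "p \<in> chart_dom c" "p \<in> chart_dom d"
  shows "transition c d differentiable (at (coord c p))"
  using assms by (intro smooth_on_imp_differentiable(1)[OF compatible open_overlap]) auto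

lemma has_derivative_transition:
  assumes "c \<in> A" "d \<in> A" "p \<in> chart_dom c" "p \<in> chart_dom d"
  shows "(transition c d has_derivative (\<lambda>v. jacobian (transition c d) (at (coord c p)) *v v)) (at (coord c p))"
  using transition_differentiable[OF assms] jacobian_works by blast

text \<open>The chain rule for \<open>transition c d\<close>. The curve factors through the chart
  \<open>c\<close> only while it stays in its domain, that is near \<open>t\<close>, whence the
  continuity assumption.\<close>

lemma velocity_transition:
  assumes c: "c \<in> A" and d: "d \<in> A" and t: "\<gamma> t \<in> chart_dom c" "\<gamma> t \<in> chart_dom d" "t \<in> T"
    and cont: "continuous (at t within T) \<gamma>"
    and D: "((coord c \<circ> \<gamma>) has_vector_derivative D) (at t within T)"
  shows "((coord d \<circ> \<gamma>) has_vector_derivative jacobian (transition c d) (at (coord c (\<gamma> t))) *v D) (at t within T)"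
proof -
  let ?J = "jacobian (transition c d) (at (coord c (\<gamma> t)))"
  have "((transition c d \<circ> (coord c \<circ> \<gamma>)) has_derivative ((\<lambda>v. ?J *v v) \<circ> (\<lambda>x. x *\<^sub>R D))) (at t within T)"
    using has_derivative_transition[OF c d t(1,2)] D
    by (intro diff_chain_within) (auto simp: has_vector_derivative_def intro: has_derivative_at_withinI)
  then have 1: "((transition c d \<circ> (coord c \<circ> \<gamma>)) has_vector_derivative ?J *v D) (at t within T)"
    by (simp add: has_vector_derivative_def o_def matrix_vector_mult_scaleR)
  have "\<forall>\<^sub>F s in at t within T. \<gamma> s \<in> chart_dom c"
    using cont t(1) open_chart_dom[OF c] by (simp add: continuous_within topological_tendstoD)
  then have "\<forall>\<^sub>F s in at t within T. (transition c d \<circ> (coord c \<circ> \<gamma>)) s = (coord d \<circ> \<gamma>) s"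
    by eventually_elim (simp add: transition_def param_coord[OF c])
  from has_derivative_transform_eventually[OF 1[unfolded has_vector_derivative_def] this] show ?thesis
    using t(1,3) by (simp add: has_vector_derivative_def transition_def param_coord[OF c] o_def)
qed

end

context riemannian_manifold begin

lemma metric_chart:
  assumes c: "c \<in> A"
  shows "metric_chart (chart_image c) (g c)"
proof
  show "open (chart_image c)" by (rule open_chart_image[OF c])
  fix x assume x: "x \<in> chart_image c"
  note diff = smooth_on_imp_differentiable[OF metric_smooth[OF c] open_chart_image[OF c]]
  show "(\<lambda>x. g c x $ i $ j) differentiable (at x)" for i j
    by (intro differentiable_vec_nth diff(1) x)
  show "g c x $ i $ j = g c x $ j $ i" for i j
    using metric_sym[OF c x] by (simp add: transpose_def vec_eq_iff)
  show "coord_inner (g c) x v v > 0" if "v \<noteq> 0" for v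
    using metric_pos[OF c x that] .
  show "pdiff l (\<lambda>x. g c x $ i $ j) differentiable (at x)" for l i j
  proof -
    have "(\<lambda>x. pdiff l (g c) x $ i $ j) differentiable (at x)"
      by (intro differentiable_vec_nth diff(2) x)
    then obtain D where D: "((\<lambda>x. pdiff l (g c) x $ i $ j) has_derivative D) (at x)"
      unfolding differentiable_def by blast
    have "pdiff l (g c) y $ i $ j = pdiff l (\<lambda>x. g c x $ i $ j) y" if "y \<in> chart_image c" for y
      using diff(1)[OF that] by (simp add: pdiff_vec_nth differentiable_vec_nth)
    from has_derivative_transform_within_open[OF D open_chart_image[OF c] x this] show ?thesis
      by (rule differentiableI)
  qed
qed

lemma coord_inner_transition:
  assumes "c \<in> A" "d \<in> A" "p \<in> chart_dom c" "p \<in> chart_dom d"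
  shows "coord_inner (g c) (coord c p) v w = coord_inner (g d) (coord d p)
    (jacobian (transition c d) (at (coord c p)) *v v) (jacobian (transition c d) (at (coord c p)) *v w)"
proof -
  let ?J = "jacobian (transition c d) (at (coord c p))"
  have "g c (coord c p) = transpose ?J ** g d (coord d p) ** ?J"
    using metric_transform[of c d p] assms by (simp add: Let_def)
  then have "coord_inner (g c) (coord c p) v w = v \<bullet> (transpose ?J *v (g d (coord d p) *v (?J *v w)))"
    by (simp add: coord_inner_eq matrix_vector_mul_assoc matrix_mul_assoc)
  moreover have "v \<bullet> (transpose ?J *v z) = (?J *v v) \<bullet> z" for z
    using dot_lmul_matrix[of z ?J v] by (simp add: inner_commute)
  ultimately show ?thesis
    by (simp only: coord_inner_eq)
qed

lemma coord_inner_nonneg: "c \<in> A \<Longrightarrow> x \<in> chart_image c \<Longrightarrow> coord_inner (g c) x v v \<ge> 0"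
  using metric_pos[of c x v] by (cases "v = 0") (auto simp: coord_inner_eq intro: less_imp_le)

lemma coord_norm_nonneg: "c \<in> A \<Longrightarrow> x \<in> chart_image c \<Longrightarrow> coord_norm (g c) x v \<ge> 0"
  by (simp add: coord_norm_def coord_inner_nonneg)

lemma speed_nonneg: "speed A g \<gamma> t \<ge> 0"
  unfolding speed_def Let_def by (intro coord_norm_nonneg coord_in_image chart_at)

text \<open>\<open>speed\<close> uses the chart picked by \<open>chart_at\<close>, which may jump
  along the curve. Jacobians of transitions are isometries, so any chart at the point gives the same
  value and one chart can serve for a whole piece.\<close>

lemma speed_eq:
  assumes c: "c \<in> A" "\<gamma> t \<in> chart_dom c" and cont: "isCont \<gamma> t"
    and D: "((coord c \<circ> \<gamma>) has_vector_derivative D) (at t)"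
  shows "speed A g \<gamma> t = coord_norm (g c) (coord c (\<gamma> t)) D"
proof -
  let ?d = "chart_at A (\<gamma> t)" let ?J = "jacobian (transition c ?d) (at (coord c (\<gamma> t)))"
  have "vector_derivative (coord ?d \<circ> \<gamma>) (at t) = ?J *v D"
    using velocity_transition[OF c(1) chart_at(1) c(2) chart_at(2) UNIV_I cont D]
    by (rule vector_derivative_at)
  then show ?thesis
    using coord_inner_transition[OF c(1) chart_at(1) c(2) chart_at(2), of D D]
    by (simp add: speed_def Let_def coord_norm_def)
qed

text \<open>The norm attains a positive minimum and a maximum on the compact product of
  \<open>C\<close> with the unit sphere, and it is homogeneous in \<open>v\<close>. The lower bound
  makes escaping from a coordinate ball costly, the upper one makes short segments short.\<close>

lemma coord_norm_bounds:
  assumes c: "c \<in> A" and C: "compact C" "C \<noteq> {}" "C \<subseteq> chart_image c"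
  obtains a b where "a > 0" "b > 0"
    "\<And>x v. x \<in> C \<Longrightarrow> a * norm v \<le> coord_norm (g c) x v \<and> coord_norm (g c) x v \<le> b * norm v"
proof -
  let ?K = "C \<times> sphere (0 :: real^'n) 1"
  let ?N = "\<lambda>z. coord_norm (g c) (fst z) (snd z)"
  have K: "compact ?K" using C(1) by (simp add: compact_Times)
  have "axis undefined 1 \<in> sphere (0 :: real^'n) 1" by (simp add: norm_axis_1)
  then have ne: "?K \<noteq> {}" using C(2) by blast
  have cont: "continuous_on ?K ?N"
    using smooth_on_imp_continuous_on(1)[OF metric_smooth[OF c]] C(3)
    by (intro continuous_on_coord_norm continuous_intros) auto
  obtain z1 where z1: "z1 \<in> ?K" "\<And>z. z \<in> ?K \<Longrightarrow> ?N z1 \<le> ?N z"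
    using continuous_attains_inf[OF K ne cont] by blast
  obtain z2 where z2: "z2 \<in> ?K" "\<And>z. z \<in> ?K \<Longrightarrow> ?N z \<le> ?N z2"
    using continuous_attains_sup[OF K ne cont] by blast
  have pos: "?N z > 0" if "z \<in> ?K" for z
  proof -
    have "fst z \<in> chart_image c" "snd z \<noteq> 0" using that C(3) by auto
    then show ?thesis unfolding coord_norm_def by (simp add: metric_pos[OF c])
  qed
  show ?thesis
  proof (rule that[OF pos[OF z1(1)] pos[OF z2(1)]])
    fix x v assume x: "x \<in> C"
    show "?N z1 * norm v \<le> coord_norm (g c) x v \<and> coord_norm (g c) x v \<le> ?N z2 * norm v"
    proof (cases "v = 0")
      case True then show ?thesis by (simp add: coord_norm_def coord_inner_eq)
    next
      case False
      define w where "w = (1 / norm v) *\<^sub>R v"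
      have w: "(x, w) \<in> ?K" "v = norm v *\<^sub>R w" using x False by (auto simp: w_def)
      have "coord_norm (g c) x v = norm v * coord_norm (g c) x w"
        using coord_norm_scaleR[of "g c" x "norm v" w] w(2) by simp
      then show ?thesis
        using z1(2)[OF w(1)] z2(2)[OF w(1)] False by (simp add: mult.commute)
    qed
  qed
qed

end

section \<open>Lengths of piecewise continuously differentiable curves\<close>

text \<open>The break set, hidden by the quantifier in \<open>piecewise_C1_curve\<close>, becomes
  explicit so that subpaths and joins can be given theirs.\<close>

definition C1_off :: "('m::topological_space, 'n::finite) chart set \<Rightarrow> real set \<Rightarrow> (real \<Rightarrow> 'm) \<Rightarrow> bool" where
  "C1_off A K \<gamma> \<longleftrightarrow> path \<gamma> \<and> finite K \<and>
    (\<forall>a b. 0 \<le> a \<longrightarrow> a < b \<longrightarrow> b \<le> 1 \<longrightarrow> {a<..<b} \<inter> K = {} \<longrightarrow> C1_curve_on A \<gamma> a b)"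

lemma piecewise_C1_curve_iff: "piecewise_C1_curve A \<gamma> \<longleftrightarrow> (\<exists>K. C1_off A K \<gamma>)"
  by (auto simp: piecewise_C1_curve_def C1_off_def)

lemma C1_offD:
  assumes "C1_off A K \<gamma>"
  shows "path \<gamma>" "finite K"
    "0 \<le> a \<Longrightarrow> a < b \<Longrightarrow> b \<le> 1 \<Longrightarrow> {a<..<b} \<inter> K = {} \<Longrightarrow> C1_curve_on A \<gamma> a b"
  using assms by (simp_all add: C1_off_def)

lemma C1_curve_onE:
  assumes "C1_curve_on A \<gamma> a b" "c \<in> A"
  obtains D where
    "\<And>t. t \<in> {a..b} \<Longrightarrow> \<gamma> t \<in> chart_dom c \<Longrightarrow> ((coord c \<circ> \<gamma>) has_vector_derivative D t) (at t within {a..b})"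
    "continuous_on {t\<in>{a..b}. \<gamma> t \<in> chart_dom c} D"
proof -
  let ?T = "{t\<in>{a..b}. \<gamma> t \<in> chart_dom c}"
  have "\<exists>D. (\<forall>t\<in>?T. ((coord c \<circ> \<gamma>) has_vector_derivative D t) (at t within {a..b})) \<and> continuous_on ?T D"
    using assms by (simp add: C1_curve_on_def Let_def)
  then obtain D where "\<forall>t\<in>?T. ((coord c \<circ> \<gamma>) has_vector_derivative D t) (at t within {a..b})" "continuous_on ?T D"
    by blast
  then show ?thesis by (intro that[of D]) simp_all
qed

section \<open>Affine reparametrisation of curves\<close>

text \<open>Agreement is asked for on the interval only, since a join is affine in each of its
  arguments only on one half.\<close>

lemma C1_curve_on_affine:
  assumes \<gamma>: "C1_curve_on A \<gamma> a b" and im: "\<And>s. s \<in> {a'..b'} \<Longrightarrow> m * s + k \<in> {a..b}"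
    and eq: "\<And>s. s \<in> {a'..b'} \<Longrightarrow> \<delta> s = \<gamma> (m * s + k)"
  shows "C1_curve_on A \<delta> a' b'"
  unfolding C1_curve_on_def Let_def
proof
  fix c assume "c \<in> A"
  with \<gamma> obtain D where D:
    "\<And>t. t \<in> {a..b} \<Longrightarrow> \<gamma> t \<in> chart_dom c \<Longrightarrow> ((coord c \<circ> \<gamma>) has_vector_derivative D t) (at t within {a..b})"
    "continuous_on {t\<in>{a..b}. \<gamma> t \<in> chart_dom c} D"
    by (rule C1_curve_onE) blast
  let ?h = "\<lambda>s. m * s + k"
  let ?T = "{s \<in> {a'..b'}. \<delta> s \<in> chart_dom c}"
  have 1: "((coord c \<circ> \<delta>) has_vector_derivative m *\<^sub>R D (?h s)) (at s within {a'..b'})" if s: "s \<in> ?T" for s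
  proof -
    have h: "(?h has_vector_derivative m) (at s within {a'..b'})"
      unfolding has_real_derivative_iff_has_vector_derivative[symmetric] by (auto intro!: derivative_eq_intros)
    have "?h s \<in> {a..b}" "\<gamma> (?h s) \<in> chart_dom c"
      using s im[of s] eq[of s] by simp_all
    then have "((coord c \<circ> \<gamma>) has_vector_derivative D (?h s)) (at (?h s) within ?h ` {a'..b'})"
      by (rule has_vector_derivative_within_subset[OF D(1) image_subsetI[OF im]])
    from vector_diff_chain_within[OF h this]
    show ?thesis
      by (rule has_vector_derivative_transform[rotated 2]) (use s eq in simp_all)
  qed
  have 2: "continuous_on ?T (\<lambda>s. m *\<^sub>R D (?h s))"
  proof (intro continuous_on_scaleR continuous_on_const continuous_on_compose2[OF D(2)])
    show "continuous_on ?T ?h" by (intro continuous_intros)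
    show "?h ` ?T \<subseteq> {t\<in>{a..b}. \<gamma> t \<in> chart_dom c}"
    proof (rule image_subsetI)
      fix s assume "s \<in> ?T"
      then show "?h s \<in> {t\<in>{a..b}. \<gamma> t \<in> chart_dom c}"
        using im[of s] eq[of s] by simp
    qed
  qed
  show "\<exists>D. (\<forall>t\<in>?T. ((coord c \<circ> \<delta>) has_vector_derivative D t) (at t within {a'..b'}))
      \<and> continuous_on ?T D"
    by (intro exI[of _ "\<lambda>s. m *\<^sub>R D (?h s)"] conjI ballI 1 2)
qed

text \<open>Break points are compared after transport by the affine map. The image interval is
  ordered by \<open>min\<close> and \<open>max\<close>, because \<open>m < 0\<close> occurs for
  reversed curves.\<close>

lemma C1_off_affine:
  assumes \<gamma>: "C1_off A K \<gamma>" and m: "m \<noteq> 0" and im: "\<And>s. s \<in> {x..y} \<Longrightarrow> m * s + k \<in> {0..1}"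
    and eq: "\<And>s. s \<in> {x..y} \<Longrightarrow> \<delta> s = \<gamma> (m * s + k)"
    and xy: "x < y" and K: "\<And>s. s \<in> {x<..<y} \<Longrightarrow> m * s + k \<notin> K"
  shows "C1_curve_on A \<delta> x y"
proof -
  let ?h = "\<lambda>s. m * s + k"
  have ex: "\<exists>s\<in>{x<..<y}. t = ?h s" if "t \<in> {min (?h x) (?h y)<..<max (?h x) (?h y)}" for t
  proof (rule bexI[of _ "(t - k) / m"])
    show "t = ?h ((t - k) / m)" using m by simp
    show "(t - k) / m \<in> {x<..<y}"
    proof (cases "m > 0")
      case True
      then have "?h x < ?h y" using xy by simp
      then have "m * x < t - k" "t - k < m * y" using that by auto
      then show ?thesis using True by (simp add: pos_less_divide_eq pos_divide_less_eq mult.commute)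
    next
      case False
      with m have neg: "m < 0" by simp
      then have "?h y < ?h x" using xy by simp
      then have "m * y < t - k" "t - k < m * x" using that by auto
      then show ?thesis using neg by (simp add: neg_less_divide_eq neg_divide_less_eq mult.commute)
    qed
  qed
  have "C1_curve_on A \<gamma> (min (?h x) (?h y)) (max (?h x) (?h y))"
  proof -
    have "?h x \<noteq> ?h y" using m xy by simp
    then have 1: "min (?h x) (?h y) < max (?h x) (?h y)" by linarith
    have 2: "0 \<le> min (?h x) (?h y)" "max (?h x) (?h y) \<le> 1"
      using im[of x] im[of y] xy by auto
    have 3: "{min (?h x) (?h y)<..<max (?h x) (?h y)} \<inter> K = {}"
    proof (rule ccontr)
      assume "\<not> ?thesis"
      then obtain t where t: "t \<in> K" "t \<in> {min (?h x) (?h y)<..<max (?h x) (?h y)}" by blast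
      obtain s where "s \<in> {x<..<y}" "t = ?h s" using ex[OF t(2)] ..
      then show False using K t(1) by simp
    qed
    show ?thesis
      by (rule C1_offD(3)[OF \<gamma> 2(1) 1 2(2) 3])
  qed
  then show ?thesis
  proof (rule C1_curve_on_affine[where m=m and k=k])
    fix s assume s: "s \<in> {x..y}"
    show "?h s \<in> {min (?h x) (?h y)..max (?h x) (?h y)}"
    proof (cases "m \<ge> 0")
      case True
      then have "?h x \<le> ?h s" "?h s \<le> ?h y" using s by (auto intro: mult_left_mono)
      then show ?thesis by auto
    next
      case False
      then have "?h y \<le> ?h s" "?h s \<le> ?h x" using s by (auto intro: mult_left_mono_neg)
      then show ?thesis by auto
    qed
  qed (rule eq)
qed

lemma C1_off_neighbourhood:
  assumes \<gamma>: "C1_off A K \<gamma>" and t: "t \<in> {0<..<1} - K"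
  obtains a b where "a < t" "t < b" "0 \<le> a" "b \<le> 1" "{a<..<b} \<inter> K = {}" "C1_curve_on A \<gamma> a b"
proof -
  have "open ({0<..<1} - K)"
    by (intro open_Diff finite_imp_closed C1_offD(2)[OF \<gamma>]) auto
  then obtain e where e: "e > 0" "cball t e \<subseteq> {0<..<1} - K"
    using t open_contains_cball by blast
  have "cball t e = {t - e..t + e}" by (simp add: cball_eq_atLeastAtMost)
  with e have sub: "{t - e..t + e} \<subseteq> {0<..<1} - K" by simp
  have "0 \<le> t - e" "t + e \<le> 1"
    using subsetD[OF sub, of "t - e"] subsetD[OF sub, of "t + e"] e(1) by auto
  moreover have "{t - e<..<t + e} \<inter> K = {}"
    using sub by (auto simp: subset_iff)
  ultimately show ?thesis
    using e(1) by (intro that[of "t - e" "t + e"] C1_offD(3)[OF \<gamma>]) auto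
qed

lemma C1_off_isCont: "C1_off A K \<gamma> \<Longrightarrow> t \<in> {0<..<1} \<Longrightarrow> isCont \<gamma> t"
  by (intro continuous_on_interior[of "{0..1}"] C1_offD(1)[unfolded path_def]) auto

text \<open>Off the break points the derivatives over a surrounding closed interval are two-sided,
  and those are what \<open>speed\<close> refers to.\<close>

lemma C1_off_velocity:
  assumes \<gamma>: "C1_off A K \<gamma>" and t: "t \<in> {0<..<1} - K" and c: "c \<in> A" "\<gamma> t \<in> chart_dom c"
  shows "((coord c \<circ> \<gamma>) has_vector_derivative vector_derivative (coord c \<circ> \<gamma>) (at t)) (at t)"
proof -
  obtain a b where ab: "a < t" "t < b" "C1_curve_on A \<gamma> a b"
    using C1_off_neighbourhood[OF \<gamma> t] by blast
  obtain D where "((coord c \<circ> \<gamma>) has_vector_derivative D t) (at t within {a..b})"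
  proof (rule C1_curve_onE[OF ab(3) c(1)])
    fix D assume "\<And>D. ((coord c \<circ> \<gamma>) has_vector_derivative D t) (at t within {a..b}) \<Longrightarrow> thesis"
      and "\<And>t. t \<in> {a..b} \<Longrightarrow> \<gamma> t \<in> chart_dom c \<Longrightarrow> ((coord c \<circ> \<gamma>) has_vector_derivative D t) (at t within {a..b})"
    moreover have "t \<in> {a..b}" using ab by simp
    ultimately show thesis using c(2) by blast
  qed
  then have "((coord c \<circ> \<gamma>) has_vector_derivative D t) (at t)"
    using ab by (simp add: at_within_Icc_at)
  then show ?thesis
    by (simp add: vector_derivative_at)
qed

section \<open>Integrability of speed, invariance and additivity of length\<close>

context riemannian_manifold begin

text \<open>Integrability is a local property, so small intervals suffice. There a single chart
  contains the curve, and between break points the speed agrees, up to end points, with a continuous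
  function.\<close>

lemma speed_integrable:
  assumes \<gamma>: "C1_off A K \<gamma>"
  shows "speed A g \<gamma> integrable_on {0..1}"
proof -
  have cont: "continuous_on {0..1} \<gamma>"
    using C1_offD(1)[OF \<gamma>] by (simp add: path_def)
  have piece: "speed A g \<gamma> integrable_on {a..b}"
    if ab: "a \<le> b" "0 \<le> a" "b \<le> 1" "{a<..<b} \<inter> K = {}" and c: "c \<in> A" "\<And>t. t \<in> {a..b} \<Longrightarrow> \<gamma> t \<in> chart_dom c"
    for a b c
  proof (cases "a = b")
    case True then show ?thesis using integrable_on_refl[of _ a] by (simp add: cbox_interval)
  next
    case False
    then have "C1_curve_on A \<gamma> a b" using ab by (intro C1_offD(3)[OF \<gamma>]) auto
    then obtain D where D:
      "\<And>t. t \<in> {a..b} \<Longrightarrow> \<gamma> t \<in> chart_dom c \<Longrightarrow> ((coord c \<circ> \<gamma>) has_vector_derivative D t) (at t within {a..b})"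
      "continuous_on {t\<in>{a..b}. \<gamma> t \<in> chart_dom c} D"
      using c(1) by (rule C1_curve_onE) blast
    have T: "{t\<in>{a..b}. \<gamma> t \<in> chart_dom c} = {a..b}" using c(2) by auto
    have "continuous_on {a..b} (\<lambda>t. coord c (\<gamma> t))"
      using c(2) ab by (intro continuous_on_compose2[OF continuous_on_coord[OF c(1)]] continuous_on_subset[OF cont]) auto
    then have "continuous_on {a..b} (\<lambda>t. coord_norm (g c) (coord c (\<gamma> t)) (D t))"
      using D(2)[unfolded T] c(2)
      by (intro continuous_on_coord_norm[OF smooth_on_imp_continuous_on(1)[OF metric_smooth[OF c(1)]]])
        (auto intro: coord_in_image)
    then have "(\<lambda>t. coord_norm (g c) (coord c (\<gamma> t)) (D t)) integrable_on {a..b}"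
      by (rule integrable_continuous_interval)
    then show ?thesis
    \<comment> \<open>At \<open>a\<close> and \<open>b\<close> only one-sided derivatives are
      available, while \<open>speed\<close> takes the two-sided one.\<close>
    proof (rule integrable_spike_finite[where S="{a,b}", rotated 2])
      fix t assume t: "t \<in> {a..b} - {a,b}"
      then have "((coord c \<circ> \<gamma>) has_vector_derivative D t) (at t)"
        using D(1)[of t] c(2)[of t] by (simp add: at_within_Icc_at)
      moreover have "isCont \<gamma> t"
        using t ab by (intro C1_off_isCont[OF \<gamma>]) auto
      ultimately show "speed A g \<gamma> t = coord_norm (g c) (coord c (\<gamma> t)) (D t)"
        using t c by (intro speed_eq) auto
    qed simp
  qed
  have "\<exists>d>0. \<forall>u v. x \<in> cbox u v \<and> cbox u v \<subseteq> ball x d \<and> cbox u v \<subseteq> cbox 0 1 \<longrightarrow>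
    speed A g \<gamma> integrable_on cbox u v" if x: "x \<in> cbox 0 1" for x :: real
  proof -
    define c where "c = chart_at A (\<gamma> x)"
    have c: "c \<in> A" "\<gamma> x \<in> chart_dom c" using chart_at by (auto simp: c_def)
    have "(\<gamma> \<longlongrightarrow> \<gamma> x) (at x within {0..1})"
      using cont x by (simp add: continuous_on_def)
    then have "\<forall>\<^sub>F t in at x within {0..1}. \<gamma> t \<in> chart_dom c"
      using c open_chart_dom by (simp add: topological_tendstoD)
    then obtain d1 where d1: "d1 > 0" "\<And>t. t \<in> {0..1} \<Longrightarrow> dist t x < d1 \<Longrightarrow> \<gamma> t \<in> chart_dom c"
      using c(2) unfolding eventually_at by (metis dist_nz)
    obtain d2 where d2: "d2 > 0" "\<And>t. t \<in> K \<Longrightarrow> t \<noteq> x \<Longrightarrow> d2 \<le> dist x t"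
      using finite_set_avoid[OF C1_offD(2)[OF \<gamma>], of x] by auto
    show ?thesis
    proof (rule exI[of _ "min d1 d2"], intro conjI allI impI; (elim conjE)?)
      show "0 < min d1 d2" using d1 d2 by simp
      fix u v assume uv: "x \<in> cbox u v" "cbox u v \<subseteq> ball x (min d1 d2)" "cbox u v \<subseteq> cbox 0 1"
      have dom: "\<gamma> t \<in> chart_dom c" if "t \<in> {u..v}" for t
        using uv that by (intro d1(2)) (auto simp: dist_commute subset_iff)
      have noK: "t \<notin> K" if "t \<in> {u..v}" "t \<noteq> x" for t
        using uv that d2(2)[of t] by (force simp: subset_iff)
      have 0: "0 \<le> u" "v \<le> 1" "u \<le> x" "x \<le> v"
        using uv by auto
      \<comment> \<open>The centre \<open>x\<close> may be a break point, but no other point of the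
        interval is; cutting at \<open>x\<close> moves it to the ends.\<close>
      have "speed A g \<gamma> integrable_on {u..x}" "speed A g \<gamma> integrable_on {x..v}"
        using 0 noK dom by (intro piece[OF _ _ _ _ c(1)]; force)+
      then show "speed A g \<gamma> integrable_on cbox u v"
        using Henstock_Kurzweil_Integration.integrable_combine[OF 0(3,4)] by simp
    qed
  qed
  then show ?thesis
    using integrable_on_little_subintervals[of "0::real" 1 "speed A g \<gamma>"] by simp
qed

lemma curve_length_nonneg: "C1_off A K \<gamma> \<Longrightarrow> curve_length A g \<gamma> \<ge> 0"
  unfolding curve_length_def by (intro integral_nonneg speed_integrable speed_nonneg)

lemma speed_affine:
  assumes \<gamma>: "C1_off A K \<gamma>" and t: "m * s + k \<in> {0<..<1} - K"
    and S: "open S" "s \<in> S" and eq: "\<And>r. r \<in> S \<Longrightarrow> \<delta> r = \<gamma> (m * r + k)"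
  shows "speed A g \<delta> s = \<bar>m\<bar> * speed A g \<gamma> (m * s + k)"
proof -
  let ?h = "\<lambda>s. m * s + k"
  let ?c = "chart_at A (\<gamma> (?h s))"
  let ?D = "vector_derivative (coord ?c \<circ> \<gamma>) (at (?h s))"
  have h: "(?h has_vector_derivative m) (at s)"
    unfolding has_real_derivative_iff_has_vector_derivative[symmetric] by (auto intro!: derivative_eq_intros)
  have D: "((coord ?c \<circ> \<gamma>) has_vector_derivative ?D) (at (?h s))"
    by (intro C1_off_velocity[OF \<gamma> t] chart_at)
  have "((coord ?c \<circ> \<gamma> \<circ> ?h) has_vector_derivative m *\<^sub>R ?D) (at s)"
    using vector_diff_chain_at[OF h D] .
  then have "((coord ?c \<circ> \<delta>) has_vector_derivative m *\<^sub>R ?D) (at s)"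
    by (rule has_vector_derivative_transform_within_open[OF _ S]) (simp add: eq)
  then have "vector_derivative (coord ?c \<circ> \<delta>) (at s) = m *\<^sub>R ?D"
    by (rule vector_derivative_at)
  then show ?thesis
    by (simp add: speed_def Let_def eq[OF S(2)] coord_norm_scaleR)
qed

text \<open>The factor \<open>\<bar>m\<bar>\<close> of the speed cancels that of the substitution.
  Subpaths, the halves of a join and, for negative \<open>m\<close>, reversed curves are all
  instances.\<close>

lemma has_integral_speed_affine:
  assumes \<gamma>: "C1_off A K \<gamma>" and m: "m \<noteq> 0" and xy: "x \<le> y"
    and im: "(\<lambda>s. m * s + k) ` {x..y} = {a..b}" "{a..b} \<subseteq> {0..1}"
    and eq: "\<And>s. s \<in> {x..y} \<Longrightarrow> \<delta> s = \<gamma> (m * s + k)"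
  shows "(speed A g \<delta> has_integral integral {a..b} (speed A g \<gamma>)) {x..y}"
proof -
  let ?h = "\<lambda>s. m * s + k"
  let ?I = "integral {a..b} (speed A g \<gamma>)"
  have "speed A g \<gamma> integrable_on {a..b}"
    using integrable_on_subinterval[OF speed_integrable[OF \<gamma>]] im(2) by simp
  then have "(speed A g \<gamma> has_integral ?I) (cbox a b)"
    by (simp add: integrable_integral)
  from has_integral_affinity[OF this m, of k]
  have "((\<lambda>s. speed A g \<gamma> (?h s)) has_integral ?I / \<bar>m\<bar>) ((\<lambda>t. (1 / m) * t + - ((1 / m) * k)) ` {a..b})"
    by (simp add: divide_inverse mult.commute)
  moreover have "(\<lambda>t. (1 / m) * t + - ((1 / m) * k)) ` {a..b} = {x..y}"
    using m unfolding im(1)[symmetric] image_image by (simp add: field_simps)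
  ultimately have "((\<lambda>s. speed A g \<gamma> (?h s)) has_integral ?I / \<bar>m\<bar>) {x..y}"
    by simp
  from has_integral_mult_right[OF this, of "\<bar>m\<bar>"]
  have I: "((\<lambda>s. \<bar>m\<bar> * speed A g \<gamma> (?h s)) has_integral ?I) {x..y}"
    using m by simp
  have inj: "inj ?h" using m by (auto intro: injI)
  \<comment> \<open>Excepted are the parameters sent to break points or ends of
    \<open>\<gamma>\<close>, and \<open>x\<close> and \<open>y\<close>, near which
    \<open>\<delta>\<close> is controlled on one side only.\<close>
  have fin: "finite ({x, y} \<union> ?h -` (K \<union> {0, 1}))"
    using finite_vimageI[OF _ inj, of "K \<union> {0, 1}"] C1_offD(2)[OF \<gamma>] by simp
  show ?thesis
  proof (rule has_integral_spike_finite[OF fin _ I])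
    fix s assume s: "s \<in> {x..y} - ({x, y} \<union> ?h -` (K \<union> {0, 1}))"
    then have "?h s \<in> {0..1}" using im by blast
    with s have "?h s \<in> {0<..<1} - K" by auto
    then show "speed A g \<delta> s = \<bar>m\<bar> * speed A g \<gamma> (?h s)"
      using s eq by (intro speed_affine[OF \<gamma>, of _ _ _ "{x<..<y}"]) auto
  qed
qed

lemma C1_off_subpath:
  assumes \<gamma>: "C1_off A K \<gamma>" and m: "m \<noteq> 0" and im: "(\<lambda>s. m * s + k) ` {0..1} = {a..b}" "{a..b} \<subseteq> {0..1}"
  shows "\<exists>K'. C1_off A K' (\<lambda>s. \<gamma> (m * s + k))"
    and "curve_length A g (\<lambda>s. \<gamma> (m * s + k)) = integral {a..b} (speed A g \<gamma>)"
proof -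
  let ?h = "\<lambda>s. m * s + k"
  have inj: "inj ?h" using m by (auto intro: injI)
  have "C1_off A (?h -` K) (\<lambda>s. \<gamma> (?h s))"
    unfolding C1_off_def
  proof (intro conjI allI impI)
    show "path (\<lambda>s. \<gamma> (?h s))"
      using C1_offD(1)[OF \<gamma>] im unfolding path_def
      by (intro continuous_on_compose2[of "{0..1}" \<gamma> "{0..1}" ?h] continuous_intros) auto
    show "finite (?h -` K)"
      by (rule finite_vimageI[OF C1_offD(2)[OF \<gamma>] inj])
    fix x y :: real assume xy: "0 \<le> x" "x < y" "y \<le> 1" "{x<..<y} \<inter> ?h -` K = {}"
    have "?h s \<in> {0..1}" if "s \<in> {x..y}" for s
    proof -
      have "?h s \<in> ?h ` {0..1}" using that xy by (intro imageI) auto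
      then show ?thesis using im(2) unfolding im(1) by blast
    qed
    then show "C1_curve_on A (\<lambda>s. \<gamma> (?h s)) x y"
      using xy by (intro C1_off_affine[OF \<gamma> m]) auto
  qed
  then show "\<exists>K'. C1_off A K' (\<lambda>s. \<gamma> (?h s))" ..
  show "curve_length A g (\<lambda>s. \<gamma> (?h s)) = integral {a..b} (speed A g \<gamma>)"
    unfolding curve_length_def using has_integral_speed_affine[OF \<gamma> m _ im] by (intro integral_unique) auto
qed

lemma C1_off_join:
  assumes \<gamma>: "C1_off A K1 \<gamma>" and \<delta>: "C1_off A K2 \<delta>" and ends: "pathfinish \<gamma> = pathstart \<delta>"
  shows "\<exists>K'. C1_off A K' (\<gamma> +++ \<delta>)"
    and "curve_length A g (\<gamma> +++ \<delta>) = curve_length A g \<gamma> + curve_length A g \<delta>"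
proof -
  let ?j = "\<gamma> +++ \<delta>"
  have eq1: "?j s = \<gamma> (2 * s + 0)" if "s \<in> {0..1/2}" for s
    using that by (simp add: joinpaths_def)
  have eq2: "?j s = \<delta> (2 * s + -1)" if "s \<in> {1/2..1}" for s
  \<comment> \<open>At \<open>1/2\<close> the join takes its first branch, so this formula holds
    there only because the ends match.\<close>
  proof (cases "s = 1/2")
    case True show ?thesis
      unfolding True using ends by (simp add: joinpaths_def pathfinish_def pathstart_def)
  qed (use that in \<open>auto simp: joinpaths_def\<close>)
  have fin: "finite ((\<lambda>s::real. 2 * s + k) -` K)" if "finite K" for k K
    using that by (intro finite_vimageI) (auto intro: injI)
  \<comment> \<open>The joint \<open>1/2\<close> becomes a break point, as the two velocities there
    need not agree.\<close>
  define K' where "K' = {1/2} \<union> (\<lambda>s. 2 * s + 0) -` K1 \<union> (\<lambda>s. 2 * s + -1) -` K2"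
  have "C1_off A K' ?j"
    unfolding C1_off_def
  proof (intro conjI allI impI)
    show "path ?j" using C1_offD(1)[OF \<gamma>] C1_offD(1)[OF \<delta>] ends by (rule path_join_imp)
    show "finite K'"
      unfolding K'_def by (intro finite_UnI fin C1_offD(2)[OF \<gamma>] C1_offD(2)[OF \<delta>]) simp
    fix x y :: real assume xy: "0 \<le> x" "x < y" "y \<le> 1" "{x<..<y} \<inter> K' = {}"
    then have "1/2 \<notin> {x<..<y}" by (auto simp: K'_def)
    then consider "y \<le> 1/2" | "1/2 \<le> x" by fastforce
    then show "C1_curve_on A ?j x y"
    proof cases
      case 1 then show ?thesis
        using xy eq1 by (intro C1_off_affine[OF \<gamma>, where m=2 and k=0]) (auto simp: K'_def set_eq_iff)
    next
      case 2 then show ?thesis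
        using xy eq2 by (intro C1_off_affine[OF \<delta>, where m=2 and k="-1"]) (auto simp: K'_def set_eq_iff)
    qed
  qed
  then show "\<exists>K'. C1_off A K' ?j" ..
  have "(speed A g ?j has_integral integral {0..1} (speed A g \<gamma>)) {0..1/2}"
    using eq1 by (intro has_integral_speed_affine[OF \<gamma>, where m=2 and k=0]) auto
  moreover have "(speed A g ?j has_integral integral {0..1} (speed A g \<delta>)) {1/2..1}"
    using eq2 by (intro has_integral_speed_affine[OF \<delta>, where m=2 and k="-1"])
      (auto simp: image_affinity_atLeastAtMost[of 2 "-1", simplified])
  ultimately have "(speed A g ?j has_integral integral {0..1} (speed A g \<gamma>) + integral {0..1} (speed A g \<delta>)) {0..1}"
    by (rule has_integral_combine[rotated 2]) auto
  then show "curve_length A g ?j = curve_length A g \<gamma> + curve_length A g \<delta>"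
    unfolding curve_length_def by (rule integral_unique)
qed

end

section \<open>The Riemannian distance\<close>

context riemannian_manifold begin

section \<open>Upper and lower length estimates within one chart\<close>

lemma continuous_on_velocity:
  assumes "c \<in> A" "d \<in> A"
  shows "continuous_on (coord c ` (chart_dom c \<inter> chart_dom d)) (\<lambda>z. jacobian (transition c d) (at z) *v w)"
proof -
  let ?O = "coord c ` (chart_dom c \<inter> chart_dom d)"
  have sm: "smooth_on ?O (transition c d)" using assms by (rule compatible)
  have "jacobian (transition c d) (at z) *v w = (\<Sum>i\<in>UNIV. w $ i *\<^sub>R pdiff i (transition c d) z)" if "z \<in> ?O" for z
  proof -
    have diff: "transition c d differentiable (at z)"
      using smooth_on_imp_differentiable(1)[OF sm open_overlap[OF assms] that] .
    from has_derivative_unique[OF has_derivative_pdiff[OF this] jacobian_works[THEN iffD1, OF this]]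
    show ?thesis by (simp add: fun_eq_iff)
  qed
  moreover have "continuous_on ?O (\<lambda>z. \<Sum>i\<in>UNIV. w $ i *\<^sub>R pdiff i (transition c d) z)"
    by (intro continuous_on_sum continuous_on_scaleR continuous_on_const smooth_on_imp_continuous_on(2)[OF sm])
  ultimately show ?thesis by simp
qed

text \<open>Coordinate segments bound the distance from above. A curve must be continuously
  differentiable in every chart, so the constant velocity is carried into each chart
  \<open>d\<close> by the Jacobian of the transition.\<close>

lemma segment_curve:
  assumes c: "c \<in> A" and B: "convex B" "B \<subseteq> chart_image c" and xy: "x \<in> B" "y \<in> B"
    and b: "\<And>z v. z \<in> B \<Longrightarrow> coord_norm (g c) z v \<le> b * norm v"
  obtains K \<gamma> where "C1_off A K \<gamma>" "\<gamma> 0 = param c x" "\<gamma> 1 = param c y"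
    "curve_length A g \<gamma> \<le> b * norm (y - x)"
proof -
  define l where "l t = x + t *\<^sub>R (y - x)" for t :: real
  define \<gamma> where "\<gamma> t = param c (l t)" for t
  have l: "l t \<in> B" if "t \<in> {0..1}" for t
    using convexD_alt[OF B(1) xy, of t] that by (simp add: l_def algebra_simps)
  have lc: "l t \<in> chart_image c" if "t \<in> {0..1}" for t using l[OF that] B(2) by blast
  have dom: "\<gamma> t \<in> chart_dom c" and co: "coord c (\<gamma> t) = l t" if "t \<in> {0..1}" for t
    using lc[OF that] c by (auto simp: \<gamma>_def param_in_dom coord_param)
  have contl: "continuous_on S l" for S unfolding l_def by (intro continuous_intros)
  have cont: "continuous_on {0..1} \<gamma>"
    unfolding \<gamma>_def using lc
    by (intro continuous_on_compose2[OF continuous_on_param[OF c] contl[of "{0..1}"]] image_subsetI)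
  have dl: "(l has_vector_derivative (y - x)) (at t within T)" for t T
    unfolding l_def[abs_def] has_vector_derivative_def by (auto intro!: derivative_eq_intros)
  have vel: "((coord c \<circ> \<gamma>) has_vector_derivative (y - x)) (at t within T)" if "t \<in> T" "T \<subseteq> {0..1}" for t T
    by (rule has_vector_derivative_transform[OF _ _ dl]) (use that co in \<open>simp_all add: subset_iff\<close>)
  have "C1_off A {} \<gamma>"
    unfolding C1_off_def
  proof (intro conjI allI impI)
    show "path \<gamma>" using cont by (simp add: path_def)
    fix s t :: real assume st: "0 \<le> s" "s < t" "t \<le> 1"
    then have sub: "{s..t} \<subseteq> {0..1}" by auto
    show "C1_curve_on A \<gamma> s t"
      unfolding C1_curve_on_def Let_def
    proof
      fix d assume d: "d \<in> A"
      let ?T = "{r\<in>{s..t}. \<gamma> r \<in> chart_dom d}"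
      let ?D = "\<lambda>r. jacobian (transition c d) (at (l r)) *v (y - x)"
      have 1: "((coord d \<circ> \<gamma>) has_vector_derivative ?D r) (at r within {s..t})" if r: "r \<in> ?T" for r
      proof -
        have r01: "r \<in> {0..1}" using r sub by auto
        have "continuous (at r within {s..t}) \<gamma>"
          using continuous_on_subset[OF cont sub] r by (simp add: continuous_on_eq_continuous_within)
        then show ?thesis
          using velocity_transition[OF c d dom[OF r01] _ _ _ vel[OF _ sub]] r co[OF r01] by simp
      qed
      have 2: "continuous_on ?T ?D"
      proof (rule continuous_on_compose2[OF continuous_on_velocity[OF c d] contl])
        show "l ` ?T \<subseteq> coord c ` (chart_dom c \<inter> chart_dom d)"
        proof (rule image_subsetI)
          fix r assume r: "r \<in> ?T"
          then have r01: "r \<in> {0..1}" using sub by auto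
          then show "l r \<in> coord c ` (chart_dom c \<inter> chart_dom d)"
            using r co[OF r01] dom[OF r01] by (intro image_eqI[of _ _ "\<gamma> r"]) auto
        qed
      qed
      show "\<exists>D. (\<forall>r\<in>?T. ((coord d \<circ> \<gamma>) has_vector_derivative D r) (at r within {s..t})) \<and> continuous_on ?T D"
        by (intro exI[of _ ?D] conjI ballI 1 2)
    qed
  qed simp
  moreover have "curve_length A g \<gamma> \<le> b * norm (y - x)"
  proof -
    have "integral {0..1} (speed A g \<gamma>) = integral {0..1} (\<lambda>t. coord_norm (g c) (l t) (y - x))"
    proof (rule integral_spike[where S="{0,1}"])
      fix t :: real assume t: "t \<in> {0..1} - {0,1}"
      then have t': "t \<in> {0<..<1}" "t \<in> {0..1}" by auto
      have v: "((coord c \<circ> \<gamma>) has_vector_derivative (y - x)) (at t)"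
        using vel[of t "{0..1}"] t' by (simp add: at_within_Icc_at)
      show "coord_norm (g c) (l t) (y - x) = speed A g \<gamma> t"
        using speed_eq[OF c dom[OF t'(2)] C1_off_isCont[OF calculation t'(1)] v] co[OF t'(2)] by simp
    qed simp
    also have "\<dots> \<le> integral {0..1} (\<lambda>t::real. b * norm (y - x))"
    proof (rule integral_le)
      have "continuous_on {0..1} (\<lambda>t. coord_norm (g c) (l t) (y - x))"
        using lc by (intro continuous_on_coord_norm[OF smooth_on_imp_continuous_on(1)[OF metric_smooth[OF c]]] contl continuous_on_const) auto
      then show "(\<lambda>t. coord_norm (g c) (l t) (y - x)) integrable_on {0..1}"
        by (rule integrable_continuous_interval)
    qed (use l b in auto)
    finally show ?thesis by (simp add: curve_length_def)
  qed
  ultimately show ?thesis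
    by (intro that[of "{}" \<gamma>]) (auto simp: \<gamma>_def l_def)
qed

text \<open>Up to its first exit time the curve stays in the closed coordinate ball, where the speed
  is at least \<open>a\<close> times the Euclidean speed of the coordinates, and these have to
  travel at least \<open>r\<close>.\<close>

lemma escape_length:
  assumes c: "c \<in> A" and p: "p \<in> chart_dom c" and r: "cball (coord c p) r \<subseteq> chart_image c" "r > 0"
    and a: "a > 0" "\<And>z v. z \<in> cball (coord c p) r \<Longrightarrow> a * norm v \<le> coord_norm (g c) z v"
    and \<gamma>: "C1_off A K \<gamma>" "\<gamma> 0 = p" "\<gamma> 1 \<notin> param c ` ball (coord c p) r"
  shows "a * r \<le> curve_length A g \<gamma>"
proof -
  let ?x = "coord c p"
  let ?V = "param c ` ball ?x r"
  let ?W = "param c ` cball ?x r"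
  have "ball ?x r \<subseteq> chart_image c" using r(1) ball_subset_cball by blast
  then have V: "open ?V" by (intro open_param_image[OF c] open_ball)
  have W: "closed ?W"
    using continuous_on_subset[OF continuous_on_param[OF c] r(1)]
    by (intro compact_imp_closed compact_continuous_image compact_cball)
  have cont: "continuous_on {0..1} \<gamma>"
    using C1_offD(1)[OF \<gamma>(1)] by (simp add: path_def)
  let ?E = "{0..1} \<inter> \<gamma> -` (- ?V)"
  have "closed ?E"
    using V by (intro continuous_closed_preimage[OF cont]) auto
  then have E: "compact ?E" by (auto simp: compact_eq_bounded_closed bounded_Int)
  moreover have "1 \<in> ?E" using \<gamma>(3) by simp
  \<comment> \<open>The first exit time from \<open>?V\<close>, attained because \<open>?V\<close>
    is open.\<close>
  ultimately obtain \<tau> where \<tau>: "\<tau> \<in> ?E" "\<And>t. t \<in> ?E \<Longrightarrow> \<tau> \<le> t"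
    using compact_attains_inf[of ?E] by blast
  have inV: "\<gamma> t \<in> ?V" if "0 \<le> t" "t < \<tau>" for t
    using \<tau>(2)[of t] \<tau>(1) that by force
  have "p \<in> ?V"
    using r(2) param_coord[OF c p] by (intro image_eqI[of _ _ ?x]) auto
  then have \<tau>0: "0 < \<tau>" "\<tau> \<le> 1" using \<tau>(1) \<gamma>(2) by (auto simp: less_le)
  have VW: "?V \<subseteq> ?W" by (intro image_mono ball_subset_cball)
  \<comment> \<open>At \<open>\<tau>\<close> the curve has left \<open>?V\<close>, but as a limit of
    points of \<open>?V\<close> it is still in the closed set \<open>?W\<close>, hence in the
    chart.\<close>
  have "\<gamma> \<tau> \<in> ?W"
  proof -
    have "closed ({0..\<tau>} \<inter> \<gamma> -` ?W)"
      using \<tau>0 by (intro continuous_closed_preimage[OF continuous_on_subset[OF cont]] W) auto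
    moreover have "{0<..<\<tau>} \<subseteq> {0..\<tau>} \<inter> \<gamma> -` ?W"
    proof
      fix t assume "t \<in> {0<..<\<tau>}"
      then have "t \<in> {0..\<tau>}" "\<gamma> t \<in> ?V" using inV[of t] by simp_all
      then show "t \<in> {0..\<tau>} \<inter> \<gamma> -` ?W" using VW by blast
    qed
    ultimately have "closure {0<..<\<tau>} \<subseteq> {0..\<tau>} \<inter> \<gamma> -` ?W"
      by (intro closure_minimal)
    moreover have "\<tau> \<in> closure {0<..<\<tau>}" using \<tau>0 by simp
    ultimately show ?thesis by blast
  qed
  have inW: "\<gamma> t \<in> ?W" if "t \<in> {0..\<tau>}" for t
  proof (cases "t = \<tau>")
    case False
    then have "\<gamma> t \<in> ?V" using inV[of t] that by simp
    then show ?thesis using VW by blast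
  qed (use \<open>\<gamma> \<tau> \<in> ?W\<close> in simp)
  have dom: "\<gamma> t \<in> chart_dom c" and ball: "coord c (\<gamma> t) \<in> cball ?x r" if t: "t \<in> {0..\<tau>}" for t
  proof -
    obtain z where "z \<in> cball ?x r" "\<gamma> t = param c z" using inW[OF t] by blast
    moreover from this have "z \<in> chart_image c" using r(1) by blast
    ultimately show "\<gamma> t \<in> chart_dom c" "coord c (\<gamma> t) \<in> cball ?x r"
      using c by (auto simp: param_in_dom coord_param)
  qed
  have "coord c (\<gamma> \<tau>) \<notin> ball ?x r"
  proof
    assume "coord c (\<gamma> \<tau>) \<in> ball ?x r"
    then have "\<gamma> \<tau> \<in> ?V"
      using param_coord[OF c dom[of \<tau>]] \<tau>0 by (intro image_eqI[of _ _ "coord c (\<gamma> \<tau>)"]) auto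
    then show False using \<tau>(1) by blast
  qed
  then have dist: "norm (coord c (\<gamma> \<tau>) - ?x) \<ge> r"
    by (simp add: dist_norm norm_minus_commute)
  let ?f = "coord c \<circ> \<gamma>"
  \<comment> \<open>Zero at the break points and the ends, where no derivative is controlled and the
    bound by the speed then holds trivially.\<close>
  define f' where "f' t = (if t \<in> K \<union> {0, \<tau>} then 0 else vector_derivative ?f (at t))" for t
  have vel: "(?f has_vector_derivative f' t) (at t)" if "t \<in> {0<..<\<tau>} - K" for t
    using C1_off_velocity[OF \<gamma>(1) _ c dom[of t]] that \<tau>0 by (simp add: f'_def)
  have "(f' has_integral (?f \<tau> - ?f 0)) {0..\<tau>}"
  proof (rule fundamental_theorem_of_calculus_interior_strong[OF C1_offD(2)[OF \<gamma>(1)]])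
    show "continuous_on {0..\<tau>} ?f"
      using dom \<tau>0 unfolding o_def
      by (intro continuous_on_compose2[OF continuous_on_coord[OF c] continuous_on_subset[OF cont]]) auto
    show "(?f has_vector_derivative f' t) (at t)" if "t \<in> {0<..<\<tau>} - K" for t
      using that by (rule vel)
  qed (use \<tau>0 in simp)
  then have f': "f' integrable_on {0..\<tau>}" "integral {0..\<tau>} f' = coord c (\<gamma> \<tau>) - ?x"
    using \<gamma>(2) by (auto simp: has_integral_iff)
  have sp: "speed A g \<gamma> integrable_on {0..\<tau>}"
    using integrable_on_subinterval[OF speed_integrable[OF \<gamma>(1)]] \<tau>0 by simp
  have bound: "norm (f' t) \<le> (1/a) * speed A g \<gamma> t" if t: "t \<in> {0..\<tau>}" for t
  proof (cases "t \<in> K \<union> {0, \<tau>}")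
    case True then show ?thesis using speed_nonneg a(1) by (simp add: f'_def)
  next
    case False
    then have t': "t \<in> {0<..<\<tau>} - K" "t \<in> {0<..<1}" using t \<tau>0 by auto
    have "a * norm (f' t) \<le> coord_norm (g c) (coord c (\<gamma> t)) (f' t)"
      using a(2)[OF ball[OF t]] .
    also have "\<dots> = speed A g \<gamma> t"
      using speed_eq[OF c dom[OF t] C1_off_isCont[OF \<gamma>(1) t'(2)] vel[OF t'(1)]] by simp
    finally show ?thesis using a(1) by (simp add: field_simps)
  qed
  have "r \<le> norm (integral {0..\<tau>} f')" using dist f'(2) by simp
  also have "\<dots> \<le> integral {0..\<tau>} (\<lambda>t. (1/a) * speed A g \<gamma> t)"
    using sp by (intro integral_norm_bound_integral f'(1) integrable_on_mult_right bound)
  also have "\<dots> = (1/a) * integral {0..\<tau>} (speed A g \<gamma>)"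
    by simp
  also have "\<dots> \<le> (1/a) * curve_length A g \<gamma>"
    unfolding curve_length_def using \<tau>0 a(1) speed_nonneg
    by (intro mult_left_mono integral_subset_le sp speed_integrable[OF \<gamma>(1)]) auto
  finally show ?thesis using a(1) by (simp add: field_simps)
qed

section \<open>Distance as an infimum and existence of curves\<close>

lemma riem_dist_alt:
  "riem_dist A g p q = Inf {curve_length A g \<gamma> |\<gamma>. \<exists>K. C1_off A K \<gamma> \<and> \<gamma> 0 = p \<and> \<gamma> 1 = q}"
  unfolding riem_dist_def piecewise_C1_curve_iff pathstart_def pathfinish_def by simp

lemma riem_dist_le:
  assumes "C1_off A K \<gamma>"
  shows "riem_dist A g (\<gamma> 0) (\<gamma> 1) \<le> curve_length A g \<gamma>"
  unfolding riem_dist_alt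
proof (rule cInf_lower)
  show "bdd_below {curve_length A g \<delta> |\<delta>. \<exists>K. C1_off A K \<delta> \<and> \<delta> 0 = \<gamma> 0 \<and> \<delta> 1 = \<gamma> 1}"
    by (rule bdd_belowI[of _ 0]) (auto intro: curve_length_nonneg)
qed (use assms in blast)

lemma C1_off_reverse:
  assumes "C1_off A K \<gamma>"
  obtains K' \<delta> where "C1_off A K' \<delta>" "\<delta> 0 = \<gamma> 1" "\<delta> 1 = \<gamma> 0" "curve_length A g \<delta> = curve_length A g \<gamma>"
proof -
  have im: "(\<lambda>s. (-1) * s + 1) ` {0..1} = {0..1::real}"
    by (subst image_affinity_atLeastAtMost) auto
  have "\<exists>K'. C1_off A K' (\<lambda>s. \<gamma> ((-1) * s + 1))"
    "curve_length A g (\<lambda>s. \<gamma> ((-1) * s + 1)) = integral {0..1} (speed A g \<gamma>)"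
    by (rule C1_off_subpath[OF assms _ im]; simp)+
  then show ?thesis
    by (elim exE) (rule that, assumption, simp_all add: curve_length_def)
qed

text \<open>Serves both as the local step towards joining arbitrary points and, for arbitrary
  \<open>e\<close>, to show that distance balls contain a neighbourhood of their centre.\<close>

lemma local_curves:
  assumes e: "e > 0"
  shows "\<exists>U. open U \<and> p \<in> U \<and> (\<forall>q\<in>U. \<exists>K \<gamma>. C1_off A K \<gamma> \<and> \<gamma> 0 = p \<and> \<gamma> 1 = q \<and> curve_length A g \<gamma> < e)"
proof -
  define c where "c = chart_at A p"
  have c: "c \<in> A" and p: "p \<in> chart_dom c" using chart_at by (auto simp: c_def)
  let ?x = "coord c p"
  obtain r where r: "r > 0" "cball ?x r \<subseteq> chart_image c"
    using open_chart_image[OF c] coord_in_image[OF p] open_contains_cball by blast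
  have "cball ?x r \<noteq> {}" using r(1) by simp
  then obtain a b where b: "b > 0" "\<And>z v. z \<in> cball ?x r \<Longrightarrow> coord_norm (g c) z v \<le> b * norm v"
    using coord_norm_bounds[OF c compact_cball _ r(2)] by metis
  \<comment> \<open>Segments from the centre have length at most \<open>b\<close> times their
    Euclidean length, so radius \<open>e / b\<close> keeps them shorter than
    \<open>e\<close>.\<close>
  define s where "s = min r (e / b)"
  have s: "0 < s" "s \<le> r" "b * s \<le> e"
    using r(1) b(1) e by (auto simp: s_def min_def field_simps)
  show ?thesis
  proof (intro exI[of _ "param c ` ball ?x s"] conjI ballI)
    have sub: "ball ?x s \<subseteq> cball ?x r" using s(2) by auto
    then show "open (param c ` ball ?x s)"
      using r(2) by (intro open_param_image[OF c]) auto
    show "p \<in> param c ` ball ?x s"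
      using s(1) param_coord[OF c p] by (intro image_eqI[of _ _ ?x]) auto
    fix q assume "q \<in> param c ` ball ?x s"
    then obtain y where y: "y \<in> ball ?x s" "q = param c y" by blast
    have "?x \<in> cball ?x r" "y \<in> cball ?x r" using y(1) sub r(1) by auto
    then obtain K \<gamma> where \<gamma>: "C1_off A K \<gamma>" "\<gamma> 0 = param c ?x" "\<gamma> 1 = param c y"
      "curve_length A g \<gamma> \<le> b * norm (y - ?x)"
      using segment_curve[OF c convex_cball r(2) _ _ b(2)] by blast
    have "b * norm (y - ?x) < b * s"
      using y(1) b(1) by (simp add: dist_norm norm_minus_commute)
    with \<gamma> s(3) show "\<exists>K \<gamma>. C1_off A K \<gamma> \<and> \<gamma> 0 = p \<and> \<gamma> 1 = q \<and> curve_length A g \<gamma> < e"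
      using param_coord[OF c p] y(2) by (intro exI[of _ K] exI[of _ \<gamma>]) auto
  qed
qed

text \<open>Being joined by such a curve is an equivalence relation with open classes, and a
  connected space has only one class. The set under the infimum in \<open>riem_dist\<close> is
  therefore nonempty.\<close>

lemma ex_curve:
  assumes "connected (UNIV :: 'm set)"
  shows "\<exists>K \<gamma>. C1_off A K \<gamma> \<and> \<gamma> 0 = p \<and> \<gamma> 1 = q"
proof (rule connected_equivalence_relation[OF assms UNIV_I UNIV_I])
  fix x y z
  show "\<exists>K \<gamma>. C1_off A K \<gamma> \<and> \<gamma> 0 = y \<and> \<gamma> 1 = x" if "\<exists>K \<gamma>. C1_off A K \<gamma> \<and> \<gamma> 0 = x \<and> \<gamma> 1 = y"
    using that C1_off_reverse by metis
  show "\<exists>K \<gamma>. C1_off A K \<gamma> \<and> \<gamma> 0 = x \<and> \<gamma> 1 = z"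
    if xy: "\<exists>K \<gamma>. C1_off A K \<gamma> \<and> \<gamma> 0 = x \<and> \<gamma> 1 = y" and yz: "\<exists>K \<gamma>. C1_off A K \<gamma> \<and> \<gamma> 0 = y \<and> \<gamma> 1 = z"
  proof -
    obtain K1 \<gamma> K2 \<delta> where *: "C1_off A K1 \<gamma>" "\<gamma> 0 = x" "\<gamma> 1 = y" "C1_off A K2 \<delta>" "\<delta> 0 = y" "\<delta> 1 = z"
      using xy yz by blast
    then obtain K' where "C1_off A K' (\<gamma> +++ \<delta>)"
      using C1_off_join(1)[of K1 \<gamma> K2 \<delta>] by (auto simp: pathfinish_def pathstart_def)
    then show ?thesis
      using * by (intro exI[of _ K'] exI[of _ "\<gamma> +++ \<delta>"]) (auto simp: joinpaths_def)
  qed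
next
  fix x
  obtain U where "open U" "x \<in> U" "\<forall>q\<in>U. \<exists>K \<gamma>. C1_off A K \<gamma> \<and> \<gamma> 0 = x \<and> \<gamma> 1 = q \<and> curve_length A g \<gamma> < 1"
    using local_curves[of 1 x] by auto
  moreover from this(3) have "\<forall>y\<in>U. \<exists>K \<gamma>. C1_off A K \<gamma> \<and> \<gamma> 0 = x \<and> \<gamma> 1 = y"
    by blast
  ultimately show "\<exists>T. openin (top_of_set UNIV) T \<and> x \<in> T \<and> (\<forall>y\<in>T. \<exists>K \<gamma>. C1_off A K \<gamma> \<and> \<gamma> 0 = x \<and> \<gamma> 1 = y)"
    by (intro exI[of _ U]) simp
qed

end

section \<open>Metric axioms and the induced topology\<close>

locale connected_riemannian_manifold = riemannian_manifold A g
  for A :: "('m::{t2_space, second_countable_topology}, 'n::finite) chart set" and g +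
  assumes conn: "connected (UNIV :: 'm set)"
begin

lemma riem_dist_lessE:
  assumes "riem_dist A g p q < e"
  obtains K \<gamma> where "C1_off A K \<gamma>" "\<gamma> 0 = p" "\<gamma> 1 = q" "curve_length A g \<gamma> < e"
proof -
  let ?L = "{curve_length A g \<gamma> |\<gamma>. \<exists>K. C1_off A K \<gamma> \<and> \<gamma> 0 = p \<and> \<gamma> 1 = q}"
  have "?L \<noteq> {}" using ex_curve[OF conn, of p q] by blast
  moreover have "Inf ?L < e" using assms by (simp add: riem_dist_alt)
  ultimately have "\<exists>l\<in>?L. l < e" by (rule cInf_lessD)
  then show ?thesis using that by blast
qed

lemma riem_dist_nonneg: "0 \<le> riem_dist A g p q"
  unfolding riem_dist_alt
  using ex_curve[OF conn, of p q] by (intro cInf_greatest) (auto intro: curve_length_nonneg)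

lemma riem_dist_commute_le: "riem_dist A g q p \<le> riem_dist A g p q"
proof (rule field_le_epsilon)
  fix e :: real assume "e > 0"
  then obtain K \<gamma> where \<gamma>: "C1_off A K \<gamma>" "\<gamma> 0 = p" "\<gamma> 1 = q" "curve_length A g \<gamma> < riem_dist A g p q + e"
    using riem_dist_lessE[of p q "riem_dist A g p q + e"] by auto
  obtain K' \<delta> where "C1_off A K' \<delta>" "\<delta> 0 = \<gamma> 1" "\<delta> 1 = \<gamma> 0" "curve_length A g \<delta> = curve_length A g \<gamma>"
    using C1_off_reverse[OF \<gamma>(1)] .
  then show "riem_dist A g q p \<le> riem_dist A g p q + e"
    using riem_dist_le[of K' \<delta>] \<gamma> by simp
qed

lemma riem_dist_triangle: "riem_dist A g p r \<le> riem_dist A g p q + riem_dist A g q r"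
proof (rule field_le_epsilon)
  fix e :: real assume e: "e > 0"
  obtain K1 \<gamma> where \<gamma>: "C1_off A K1 \<gamma>" "\<gamma> 0 = p" "\<gamma> 1 = q" "curve_length A g \<gamma> < riem_dist A g p q + e / 2"
    using riem_dist_lessE[of p q "riem_dist A g p q + e / 2"] e by auto
  obtain K2 \<delta> where \<delta>: "C1_off A K2 \<delta>" "\<delta> 0 = q" "\<delta> 1 = r" "curve_length A g \<delta> < riem_dist A g q r + e / 2"
    using riem_dist_lessE[of q r "riem_dist A g q r + e / 2"] e by auto
  have "pathfinish \<gamma> = pathstart \<delta>" using \<gamma> \<delta> by (simp add: pathfinish_def pathstart_def)
  note j = C1_off_join[OF \<gamma>(1) \<delta>(1) this]
  obtain K' where "C1_off A K' (\<gamma> +++ \<delta>)" using j(1) ..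
  from riem_dist_le[OF this] have "riem_dist A g p r \<le> curve_length A g (\<gamma> +++ \<delta>)"
    using \<gamma>(2) \<delta>(3) by (simp add: joinpaths_def)
  then show "riem_dist A g p r \<le> riem_dist A g p q + riem_dist A g q r + e"
    using j(2) \<gamma>(4) \<delta>(4) by simp
qed

text \<open>By \<open>escape_length\<close> a curve shorter than \<open>a * r\<close> cannot leave
  the coordinate ball, which is chosen inside \<open>U\<close>. Separation of points and the
  comparison of topologies both rest on this.\<close>

lemma riem_ball_subset:
  assumes "open U" "p \<in> U"
  obtains e where "e > 0" "\<And>q. riem_dist A g p q < e \<Longrightarrow> q \<in> U"
proof -
  define c where "c = chart_at A p"
  have c: "c \<in> A" and p: "p \<in> chart_dom c" using chart_at by (auto simp: c_def)
  let ?x = "coord c p"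
  have "open (coord c ` (U \<inter> chart_dom c))"
    using assms(1) open_chart_dom[OF c] by (intro open_coord_image[OF c]) auto
  moreover have "?x \<in> coord c ` (U \<inter> chart_dom c)" using p assms(2) by blast
  ultimately obtain r where r: "r > 0" "cball ?x r \<subseteq> coord c ` (U \<inter> chart_dom c)"
    using open_contains_cball by blast
  then have im: "cball ?x r \<subseteq> chart_image c" by (auto simp: chart_image_def)
  have "cball ?x r \<noteq> {}" using r(1) by simp
  then obtain a b where a: "a > 0" "\<And>z v. z \<in> cball ?x r \<Longrightarrow> a * norm v \<le> coord_norm (g c) z v"
    using coord_norm_bounds[OF c compact_cball _ im] by metis
  have pU: "param c ` ball ?x r \<subseteq> U"
  proof (rule image_subsetI)
    fix z assume "z \<in> ball ?x r"
    then have "z \<in> coord c ` (U \<inter> chart_dom c)" using r(2) ball_subset_cball[of ?x r] by blast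
    then show "param c z \<in> U" using param_coord[OF c] by auto
  qed
  show ?thesis
  proof (rule that[of "a * r"])
    show "a * r > 0" using a r by simp
    fix q assume "riem_dist A g p q < a * r"
    then obtain K \<gamma> where \<gamma>: "C1_off A K \<gamma>" "\<gamma> 0 = p" "\<gamma> 1 = q" "curve_length A g \<gamma> < a * r"
      by (rule riem_dist_lessE)
    then have "q \<in> param c ` ball ?x r"
      using escape_length[OF c p im r(1) a \<gamma>(1,2)] by fastforce
    then show "q \<in> U" using pU by blast
  qed
qed

sublocale riem: Metric_space UNIV "riem_dist A g"
proof
  show "0 \<le> riem_dist A g p q" for p q by (rule riem_dist_nonneg)
  show "riem_dist A g p q = riem_dist A g q p" for p q
    using riem_dist_commute_le[of p q] riem_dist_commute_le[of q p] by simp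
  show "riem_dist A g p r \<le> riem_dist A g p q + riem_dist A g q r" for p q r
    by (rule riem_dist_triangle)
  show "riem_dist A g p q = 0 \<longleftrightarrow> p = q" for p q
  proof
    assume 0: "riem_dist A g p q = 0"
    show "p = q"
    proof (rule ccontr)
      assume "p \<noteq> q"
      then have "p \<in> - {q}" "open (- {q})" by auto
      then obtain e where e: "e > 0" "\<And>s. riem_dist A g p s < e \<Longrightarrow> s \<in> - {q}"
        using riem_ball_subset[of "- {q}" p] by blast
      show False using e(2)[of q] e(1) 0 by simp
    qed
  next
    assume "p = q"
    have "riem_dist A g p p \<le> 0"
    proof (rule field_le_epsilon)
      fix e :: real assume e: "e > 0"
      then obtain K \<gamma> where "C1_off A K \<gamma>" "\<gamma> 0 = p" "\<gamma> 1 = p" "curve_length A g \<gamma> < e"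
        using local_curves[OF e, of p] by blast
      then show "riem_dist A g p p \<le> 0 + e"
        using riem_dist_le[of K \<gamma>] by simp
    qed
    then show "riem_dist A g p q = 0"
      using riem_dist_nonneg[of p p] \<open>p = q\<close> by simp
  qed
qed

text \<open>\<open>local_curves\<close> gives one inclusion, \<open>riem_ball_subset\<close> the
  other. The identity carries compactness of metric balls over to the topology in which continuous
  functions on the manifold attain their maxima.\<close>

lemma mtopology_riem: "riem.mtopology = euclidean"
proof (rule topology_eq[THEN iffD2], intro allI iffI)
  fix U :: "'m set"
  assume U: "openin riem.mtopology U"
  have "\<exists>T. open T \<and> p \<in> T \<and> T \<subseteq> U" if "p \<in> U" for p
  proof -
    have "\<exists>e>0. riem.mball p e \<subseteq> U"
      using U \<open>p \<in> U\<close> by (simp add: riem.openin_mtopology)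
    then obtain e where e: "e > 0" "riem.mball p e \<subseteq> U" by blast
    obtain T where T: "open T" "p \<in> T" "\<forall>q\<in>T. \<exists>K \<gamma>. C1_off A K \<gamma> \<and> \<gamma> 0 = p \<and> \<gamma> 1 = q \<and> curve_length A g \<gamma> < e"
      using local_curves[OF e(1), of p] by (elim exE conjE)
    have "riem_dist A g p q < e" if q: "q \<in> T" for q
    proof -
      obtain K \<gamma> where "C1_off A K \<gamma>" "\<gamma> 0 = p" "\<gamma> 1 = q" "curve_length A g \<gamma> < e"
        using T(3)[rule_format, OF q] by (elim exE conjE)
      then show ?thesis using riem_dist_le[of K \<gamma>] by simp
    qed
    then have "T \<subseteq> riem.mball p e" by auto
    then have "T \<subseteq> U" using e(2) by (rule subset_trans)
    with T show ?thesis by blast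
  qed
  then have "open U" by (subst open_subopen) simp
  then show "openin euclidean U" by simp
next
  fix U :: "'m set" assume "openin euclidean U"
  then have U: "open U" by simp
  show "openin riem.mtopology U"
    unfolding riem.openin_mtopology
  proof (intro conjI allI impI)
    fix p assume "p \<in> U"
    then obtain e where "e > 0" "\<And>q. riem_dist A g p q < e \<Longrightarrow> q \<in> U"
      using riem_ball_subset[OF U] by blast
    then show "\<exists>r>0. riem.mball p r \<subseteq> U" by auto
  qed simp
qed

text \<open>The length of an initial piece depends continuously on the cut, so a curve shorter than
  \<open>s + t\<close> can be cut into pieces shorter than \<open>s\<close> and
  \<open>t\<close>.\<close>

lemma riem_dist_split:
  assumes "0 < s" "0 < t" "riem_dist A g p q < s + t"
  shows "\<exists>z. riem_dist A g p z < s \<and> riem_dist A g z q < t"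
proof -
  obtain K \<gamma> where \<gamma>: "C1_off A K \<gamma>" "\<gamma> 0 = p" "\<gamma> 1 = q" "curve_length A g \<gamma> < s + t"
    using assms(3) by (rule riem_dist_lessE)
  define L where "L = curve_length A g \<gamma>"
  show ?thesis
  proof (cases "L < s")
    case True
    then show ?thesis
      using riem_dist_le[OF \<gamma>(1)] \<gamma>(2,3) assms(2) by (intro exI[of _ q]) (simp add: L_def)
  next
    case False
    let ?F = "\<lambda>\<tau>. integral {0..\<tau>} (speed A g \<gamma>)"
    \<comment> \<open>Midway between \<open>max 0 (L - t)\<close> and \<open>s\<close>: the first
      piece is then shorter than \<open>s\<close>, the rest \<open>L - v\<close> shorter than
      \<open>t\<close>, and the cut is interior.\<close>
    define v where "v = (max 0 (L - t) + s) / 2"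
    have v: "0 < v" "v < s" "v < L" "L - t < v"
      using assms(1,2) \<gamma>(4) False unfolding v_def L_def by (auto simp: max_def)
    have int: "speed A g \<gamma> integrable_on {0..1}" by (rule speed_integrable[OF \<gamma>(1)])
    have "\<exists>\<tau>\<ge>0. \<tau> \<le> 1 \<and> ?F \<tau> = v"
      using v int by (intro IVT' indefinite_integral_continuous_1) (auto simp: L_def curve_length_def)
    then obtain \<tau> where \<tau>: "0 \<le> \<tau>" "\<tau> \<le> 1" "?F \<tau> = v" by blast
    then have \<tau>': "0 < \<tau>" "\<tau> < 1"
      using v by (auto simp: L_def curve_length_def less_le)
    have im1: "(\<lambda>s. \<tau> * s + 0) ` {0..1} = {0..\<tau>}" "{0..\<tau>} \<subseteq> {0..1}"
      using \<tau>' by (simp_all add: image_affinity_atLeastAtMost del: add_0_right)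
    have im2: "(\<lambda>s. (1 - \<tau>) * s + \<tau>) ` {0..1} = {\<tau>..1}" "{\<tau>..1} \<subseteq> {0..1}"
      using \<tau>' by (simp_all add: image_affinity_atLeastAtMost)
    have "riem_dist A g p (\<gamma> \<tau>) \<le> v"
    proof -
      obtain K1 where "C1_off A K1 (\<lambda>s. \<gamma> (\<tau> * s + 0))"
        using C1_off_subpath(1)[OF \<gamma>(1) _ im1] \<tau>' by auto
      from riem_dist_le[OF this] show ?thesis
        using C1_off_subpath(2)[OF \<gamma>(1) _ im1] \<tau>' \<tau>(3) \<gamma>(2) by simp
    qed
    moreover have "riem_dist A g (\<gamma> \<tau>) q \<le> L - v"
    proof -
      obtain K1 where "C1_off A K1 (\<lambda>s. \<gamma> ((1 - \<tau>) * s + \<tau>))"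
        using C1_off_subpath(1)[OF \<gamma>(1) _ im2] \<tau>' by auto
      from riem_dist_le[OF this] have "riem_dist A g (\<gamma> \<tau>) q \<le> integral {\<tau>..1} (speed A g \<gamma>)"
        using C1_off_subpath(2)[OF \<gamma>(1) _ im2] \<tau>' \<gamma>(3) by simp
      moreover have "?F \<tau> + integral {\<tau>..1} (speed A g \<gamma>) = L"
        unfolding L_def curve_length_def using \<tau>(1,2) int by (rule Henstock_Kurzweil_Integration.integral_combine)
      ultimately show ?thesis using \<tau>(3) by simp
    qed
    ultimately show ?thesis using v by (intro exI[of _ "\<gamma> \<tau>"]) auto
  qed
qed

lemma ex_compact_riem_ball: "\<exists>r>0. compactin riem.mtopology (riem.mcball p r)"
proof -
  define c where "c = chart_at A p"
  have c: "c \<in> A" and p: "p \<in> chart_dom c" using chart_at by (auto simp: c_def)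
  let ?x = "coord c p"
  obtain r where r: "r > 0" "cball ?x r \<subseteq> chart_image c"
    using open_chart_image[OF c] coord_in_image[OF p] open_contains_cball by blast
  have C: "compact (param c ` cball ?x r)"
    using continuous_on_subset[OF continuous_on_param[OF c] r(2)] compact_cball by (rule compact_continuous_image)
  have "open (param c ` ball ?x r)"
    using r(2) ball_subset_cball[of ?x r] by (intro open_param_image[OF c]) auto
  moreover have "p \<in> param c ` ball ?x r"
    using r(1) param_coord[OF c p] by (intro image_eqI[of _ _ ?x]) auto
  ultimately obtain e where e: "e > 0" "\<And>q. riem_dist A g p q < e \<Longrightarrow> q \<in> param c ` ball ?x r"
    using riem_ball_subset by blast
  have "riem.mcball p (e / 2) \<subseteq> param c ` cball ?x r"
  proof
    fix q assume "q \<in> riem.mcball p (e / 2)"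
    then have "q \<in> param c ` ball ?x r" using e(1) by (intro e(2)) simp
    then show "q \<in> param c ` cball ?x r" using ball_subset_cball by blast
  qed
  moreover have "compactin riem.mtopology (param c ` cball ?x r)"
    using C by (simp add: mtopology_riem)
  ultimately have "compactin riem.mtopology (riem.mcball p (e / 2))"
    using riem.closedin_mcball closed_compactin by blast
  then show ?thesis using e(1) by (intro exI[of _ "e / 2"]) simp
qed

end

section \<open>Constancy of the potential\<close>

context metric_chart begin

lemma coord_inner_gradient:
  "x \<in> S \<Longrightarrow> coord_inner G x v (coord_gradient G U x) = (\<Sum>i\<in>UNIV. v $ i * pdiff i U x)"
  using metric_mult_inv[of x _ "\<lambda>l. pdiff l U x"]
  by (simp add: coord_inner_eq inner_vec_def matrix_vector_mult_def coord_gradient_def)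

text \<open>Differentiating the exponential twice gives \<open>- (1/m) * exp (- F x / m)\<close>
  times the left-hand side of the equation for \<open>F\<close>; the quadratic term comes from the
  second derivative of \<open>exp\<close>.\<close>

lemma conformal_chart_exp:
  assumes m: "m \<noteq> 0"
    and F: "\<And>x. x \<in> S \<Longrightarrow> F differentiable (at x)" "\<And>x i. x \<in> S \<Longrightarrow> pdiff i F differentiable (at x)"
    and \<sigma>: "\<And>x. x \<in> S \<Longrightarrow> \<sigma> differentiable (at x)"
    and hess: "\<And>x i j. x \<in> S \<Longrightarrow>
      coord_hessian G F x i j - (1/m) * (pdiff i F x * pdiff j F x) = \<sigma> x * G x $ i $ j"
  shows "conformal_chart S G (\<lambda>x. exp (- F x / m)) (\<lambda>x. - (1/m) * (\<sigma> x * exp (- F x / m)))"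
proof -
  define U where "U x = exp (- F x / m)" for x
  have dF: "(\<lambda>x. - F x / m) differentiable (at x)" if "x \<in> S" for x
    using F(1)[OF that] m by (intro differentiable_divide differentiable_minus differentiable_const)
  have U: "U differentiable (at x)" if "x \<in> S" for x
    unfolding U_def[abs_def] by (intro differentiable_exp dF that)
  have pU: "pdiff i U x = - (1/m) * (U x * pdiff i F x)" if x: "x \<in> S" for i x
  proof -
    have "pdiff i (\<lambda>x. - F x / m) x = pdiff i (\<lambda>x. - (1/m) * F x) x" by simp
    also have "\<dots> = - (1/m) * pdiff i F x"
      by (rule pdiff_cmult[OF F(1)[OF x]])
    finally show ?thesis
      unfolding U_def[abs_def] pdiff_exp[OF dF[OF x]] by simp
  qed
  have dUF: "(\<lambda>x. U x * pdiff i F x) differentiable (at x)" if "x \<in> S" for i x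
    using that by (intro differentiable_mult U F(2))
  have dpU: "pdiff i U differentiable (at x)" if x: "x \<in> S" for i x
  proof -
    have "(\<lambda>x. - (1/m) * (U x * pdiff i F x)) differentiable (at x)"
      by (intro differentiable_mult[OF differentiable_const] dUF x)
    then obtain D where "((\<lambda>x. - (1/m) * (U x * pdiff i F x)) has_derivative D) (at x)"
      unfolding differentiable_def by blast
    from has_derivative_transform_within_open[OF this open_S x pU[symmetric]] show ?thesis
      by (rule differentiableI)
  qed
  have ppU: "pdiff i (pdiff j U) x = - (1/m) * (pdiff i U x * pdiff j F x + U x * pdiff i (pdiff j F) x)"
    if x: "x \<in> S" for i j x
  proof -
    have "pdiff i (pdiff j U) x = pdiff i (\<lambda>x. - (1/m) * (U x * pdiff j F x)) x"
      by (rule pdiff_cong[OF open_S x pU])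
    also have "\<dots> = - (1/m) * pdiff i (\<lambda>x. U x * pdiff j F x) x"
      by (rule pdiff_cmult[OF dUF[OF x]])
    finally show ?thesis by (simp add: pdiff_mult[OF U[OF x] F(2)[OF x]])
  qed
  show ?thesis
  proof (unfold_locales, fold U_def)
    fix x assume x: "x \<in> S"
    show "(\<lambda>x. U x) differentiable (at x)" by (rule U[OF x])
    show "pdiff i (\<lambda>x. U x) differentiable (at x)" for i by (rule dpU[OF x])
    show "(\<lambda>x. - (1/m) * (\<sigma> x * U x)) differentiable (at x)"
      by (intro differentiable_mult[OF differentiable_const] differentiable_mult \<sigma> U x)
    show "coord_hessian G (\<lambda>x. U x) x i j = - (1/m) * (\<sigma> x * U x) * G x $ i $ j" for i j
    proof -
      have "coord_hessian G U x i j =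
          - (1/m) * (U x * (coord_hessian G F x i j - (1/m) * (pdiff i F x * pdiff j F x)))"
        by (simp add: coord_hessian_def ppU[OF x] pU[OF x] algebra_simps sum_distrib_left sum_negf sum_divide_distrib)
      also have "\<dots> = - (1/m) * (\<sigma> x * U x) * G x $ i $ j"
        unfolding hess[OF x] by simp
      finally show ?thesis .
    qed
  qed
qed

end

context riemannian_manifold begin

text \<open>In both charts the gradient represents the differential of \<open>u\<close>, and the
  Jacobian of the transition is an isometry, so it maps one gradient to the other. Only then can
  \<open>gradient_norm\<close>, defined through \<open>chart_at\<close>, be differentiated in a
  given chart.\<close>

lemma gradient_norm_sq:
  assumes diff: "\<And>c x. c \<in> A \<Longrightarrow> x \<in> chart_image c \<Longrightarrow> (u \<circ> param c) differentiable (at x)"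
    and c: "c \<in> A" and p: "p \<in> chart_dom c"
  shows "(gradient_norm A g u p)\<^sup>2 = coord_inner (g c) (coord c p) (gradient g u c p) (gradient g u c p)"
proof -
  define d where "d = chart_at A p"
  have d: "d \<in> A" "p \<in> chart_dom d" using chart_at by (auto simp: d_def)
  let ?x = "coord c p" and ?y = "coord d p"
  let ?J = "jacobian (transition c d) (at ?x)"
  let ?X = "gradient g u c p" and ?Y = "gradient g u d p"
  interpret C: metric_chart "chart_image c" "g c" by (rule metric_chart[OF c])
  interpret D: metric_chart "chart_image d" "g d" by (rule metric_chart[OF d(1)])
  have x: "?x \<in> chart_image c" and y: "?y \<in> chart_image d"
    using p d(2) by (auto intro: coord_in_image)
  have xy: "transition c d ?x = ?y" by (simp add: transition_def param_coord[OF c p])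
  have du: "coord_inner (g c) ?x v ?X = coord_inner (g d) ?y (?J *v v) ?Y" for v
  proof -
    have "((u \<circ> param d) has_derivative (\<lambda>w. \<Sum>i\<in>UNIV. w $ i *\<^sub>R pdiff i (u \<circ> param d) ?y)) (at (transition c d ?x))"
      unfolding xy by (rule has_derivative_pdiff[OF diff[OF d(1) y]])
    from diff_chain_at[OF has_derivative_transition[OF c d(1) p d(2)] this]
    have 1: "((u \<circ> param d \<circ> transition c d) has_derivative
      (\<lambda>v. \<Sum>i\<in>UNIV. (?J *v v) $ i *\<^sub>R pdiff i (u \<circ> param d) ?y)) (at ?x)"
      by (simp add: o_def)
    have "((u \<circ> param c) has_derivative
      (\<lambda>v. \<Sum>i\<in>UNIV. (?J *v v) $ i *\<^sub>R pdiff i (u \<circ> param d) ?y)) (at ?x)"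
    proof (rule has_derivative_transform_within_open[OF 1 open_overlap[OF c d(1)]])
      show "?x \<in> coord c ` (chart_dom c \<inter> chart_dom d)" using p d(2) by blast
      show "(u \<circ> param d \<circ> transition c d) z = (u \<circ> param c) z"
        if "z \<in> coord c ` (chart_dom c \<inter> chart_dom d)" for z
        using that c d(1) by (auto simp: transition_def param_coord)
    qed
    from has_derivative_unique[OF this has_derivative_pdiff[OF diff[OF c x]]]
    show ?thesis
      unfolding gradient_def C.coord_inner_gradient[OF x] D.coord_inner_gradient[OF y]
      by (simp add: fun_eq_iff)
  qed
  have tr: "coord_inner (g c) ?x v w = coord_inner (g d) ?y (?J *v v) (?J *v w)" for v w
    by (rule coord_inner_transition[OF c d(1) p d(2)])
  have "inj ((*v) ?J)"
  proof (rule linear_injective_0[THEN iffD2], simp, intro allI impI)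
    fix v assume "?J *v v = 0"
    then have "coord_inner (g c) ?x v v = 0" using tr[of v v] by (simp add: coord_inner_eq)
    then show "v = 0" using metric_pos[OF c x, of v] by fastforce
  qed
  then have "surj ((*v) ?J)"
    by (intro linear_injective_imp_surjective) simp_all
  \<comment> \<open>The difference of the two vectors is orthogonal to the range of
    \<open>?J\<close>; since \<open>?J\<close> is onto, it lies in that range and must
    vanish.\<close>
  then obtain v where v: "?J *v ?X - ?Y = ?J *v v" by (metis surjD)
  have "coord_inner (g d) ?y (?J *v v) (?J *v ?X - ?Y) = 0"
    using du[of v] tr[of v ?X] by (simp add: coord_inner_eq matrix_vector_mult_diff_distrib inner_diff_right)
  then have "?J *v ?X - ?Y = 0"
    unfolding v using metric_pos[OF d(1) y, of "?J *v v"] by fastforce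
  then have "coord_inner (g c) ?x ?X ?X = coord_inner (g d) ?y ?Y ?Y"
    using tr[of ?X ?X] by simp
  then show ?thesis
    using coord_inner_nonneg[OF d(1) y]
    by (simp add: gradient_norm_def Let_def d_def[symmetric] coord_norm_def)
qed

end

theorem theorem3p3:
  fixes A :: "('m::{t2_space, second_countable_topology}, 'n::finite) chart set"
    and g :: "('m, 'n) chart \<Rightarrow> real^'n \<Rightarrow> real^'n^'n"
    and f u :: "'m \<Rightarrow> real"
    and m :: real
    and x0 :: 'm
  assumes m: "0 < m"
    and dim: "CARD('n) \<ge> 2"
    and riem: "riemannian_manifold A g"
    and conn: "connected (UNIV :: 'm set)"
    and compl: "complete_riemannian A g"
    and noncompact: "\<not> compact (UNIV :: 'm set)"
    and conformal: "modified_gradient_conformal m A g f"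
    and u: "u = (\<lambda>p. exp (- f p / m))"
    and ric: "\<forall>c\<in>A. \<forall>p\<in>chart_dom c. Ric g c p (gradient g u c p) (gradient g u c p) \<le> 0"
    and decay: "zero_at_infinity A g x0 (gradient_norm A g u)"
  shows "f constant_on UNIV"
proof -
  interpret riemannian_manifold A g by (rule riem)
  interpret connected_riemannian_manifold A g by unfold_locales (rule conn)
  obtain \<sigma> where \<sigma>: "smooth_fun A \<sigma>"
    and hess: "\<And>c p i j. c \<in> A \<Longrightarrow> p \<in> chart_dom c \<Longrightarrow>
      hessian g f c p i j - (1/m) * (differential f c p i * differential f c p j) = \<sigma> p * g c (coord c p) $ i $ j"
    and f: "smooth_fun A f"
    using conformal unfolding modified_gradient_conformal_def by blast
  define \<psi> where "\<psi> c x = - (1/m) * ((\<sigma> \<circ> param c) x * exp (- (f \<circ> param c) x / m))" for c :: "('m, 'n) chart" and x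
  have U: "u \<circ> param c = (\<lambda>x. exp (- (f \<circ> param c) x / m))" for c :: "('m, 'n) chart"
    by (simp add: u o_def)
  have chart: "conformal_chart (chart_image c) (g c) (u \<circ> param c) (\<psi> c)" if c: "c \<in> A" for c
    unfolding U \<psi>_def[abs_def]
  proof (rule metric_chart.conformal_chart_exp[OF metric_chart[OF c]])
    show "m \<noteq> 0" using m by simp
    have sm: "smooth_on (chart_image c) (f \<circ> param c)" "smooth_on (chart_image c) (\<sigma> \<circ> param c)"
      using f \<sigma> c by (auto simp: smooth_fun_def)
    note op = open_chart_image[OF c]
    fix x assume x: "x \<in> chart_image c"
    show "f \<circ> param c differentiable at x" "pdiff i (f \<circ> param c) differentiable at x"
      "\<sigma> \<circ> param c differentiable at x" for i
      using smooth_on_imp_differentiable[OF sm(1) op x] smooth_on_imp_differentiable[OF sm(2) op x] by auto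
    show "coord_hessian (g c) (f \<circ> param c) x i j - (1/m) * (pdiff i (f \<circ> param c) x * pdiff j (f \<circ> param c) x)
        = (\<sigma> \<circ> param c) x * g c x $ i $ j" for i j
      using hess[OF c param_in_dom[OF x], of i j]
      by (simp add: hessian_def differential_def coord_param[OF c x])
  qed
  \<comment> \<open>Squared, so that in every chart it is the differentiable energy.\<close>
  define h where "h p = (gradient_norm A g u p)\<^sup>2" for p
  have diffU: "(u \<circ> param c) differentiable (at x)" if "c \<in> A" "x \<in> chart_image c" for c x
    using conformal_chart.differentiable_U[OF chart] that by blast
  have h_eq: "h p = coord_inner (g c) (coord c p) (gradient g u c p) (gradient g u c p)"
    if "c \<in> A" "p \<in> chart_dom c" for c p
    unfolding h_def by (rule gradient_norm_sq[OF diffU that])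
  have no_max: False
    if e: "e > 0" and max: "\<And>p. h p + e * exp (- u p) \<le> h q + e * exp (- u q)" and pos: "h q > 0" for e q
  proof -
    define c where "c = chart_at A q"
    have c: "c \<in> A" and q: "q \<in> chart_dom c" using chart_at by (auto simp: c_def)
    interpret conformal_chart "chart_image c" "g c" "u \<circ> param c" "\<psi> c" by (rule chart[OF c])
    let ?x = "coord c q"
    have hX: "h (param c y) = coord_inner (g c) y (X y) (X y)" if "y \<in> chart_image c" for y
      using h_eq[OF c param_in_dom[OF that]] by (simp add: gradient_def coord_param[OF c that])
    have hx: "h q = coord_inner (g c) ?x (X ?x) (X ?x)"
      using h_eq[OF c q] by (simp add: gradient_def)
    show False
    proof (rule energy_no_local_max[OF coord_in_image[OF q] _ dim e])
      show "coord_Ric (g c) ?x (X ?x) (X ?x) \<le> 0"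
        using ric c q by (simp add: Ric_def gradient_def)
      show "coord_inner (g c) ?x (X ?x) (X ?x) > 0" using pos hx by simp
      show "coord_inner (g c) y (X y) (X y) + e * exp (- (u \<circ> param c) y)
          \<le> coord_inner (g c) ?x (X ?x) (X ?x) + e * exp (- (u \<circ> param c) ?x)" if "y \<in> chart_image c" for y
        using max[of "param c y"] hX[OF that] hx param_coord[OF c q] by simp
    qed
  qed
  have cont: "continuous_on UNIV (\<lambda>p. h p + e * exp (- u p))" for e
  proof -
    have "continuous_on (\<Union>c\<in>A. chart_dom c) (\<lambda>p. h p + e * exp (- u p))"
    proof (rule continuous_on_open_UN)
      fix c assume c: "c \<in> A"
      show "open (chart_dom c)" by (rule open_chart_dom[OF c])
      interpret conformal_chart "chart_image c" "g c" "u \<circ> param c" "\<psi> c" by (rule chart[OF c])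
      have "continuous_on (chart_image c) (\<lambda>x. coord_inner (g c) x (X x) (X x))"
        "continuous_on (chart_image c) (u \<circ> param c)"
        by (intro differentiable_imp_continuous_on differentiable_at_imp_differentiable_on
            differentiable_energy differentiable_U; assumption)+
      then have "continuous_on (chart_dom c) (\<lambda>p. coord_inner (g c) (coord c p) (X (coord c p)) (X (coord c p)))"
        "continuous_on (chart_dom c) (\<lambda>p. (u \<circ> param c) (coord c p))"
        by (auto intro: continuous_on_compose2[OF _ continuous_on_coord[OF c]] coord_in_image)
      then have "continuous_on (chart_dom c) (\<lambda>p. coord_inner (g c) (coord c p) (X (coord c p)) (X (coord c p))
          + e * exp (- (u \<circ> param c) (coord c p)))"
        by (intro continuous_intros)
      then show "continuous_on (chart_dom c) (\<lambda>p. h p + e * exp (- u p))"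
        by (rule continuous_on_eq) (simp add: h_eq[OF c] gradient_def param_coord[OF c])
    qed
    then show ?thesis by (simp add: covering)
  qed
  have compact_ball: "compact (riem.mcball x0 r)" for r
  proof -
    have "compactin riem.mtopology (riem.mcball x0 r)"
    proof (rule riem.compactin_mcball_length_space)
      show "riem.mcomplete" using compl by (simp add: complete_riemannian_def)
      show "\<exists>r>0. compactin riem.mtopology (riem.mcball p r)" for p by (rule ex_compact_riem_ball)
      show "\<exists>z\<in>UNIV. riem_dist A g p z < s \<and> riem_dist A g z q < t"
        if "0 < s" "0 < t" "riem_dist A g p q < s + t" for p q s t
        using riem_dist_split[OF that] by simp
    qed simp
    then show ?thesis by (simp add: mtopology_riem)
  qed
  have h0: "h p = 0" for p
  proof (rule ccontr)
    assume "h p \<noteq> 0"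
    then have hp: "h p > 0" by (simp add: h_def)
    \<comment> \<open>With half of \<open>h p\<close>, any point where \<open>h < e\<close> has
      \<open>h + e * exp (- u) < 2 * e = h p\<close>, so it cannot compete with
      \<open>p\<close>.\<close>
    define e where "e = h p / 2"
    have e: "e > 0" using hp by (simp add: e_def)
    have "((\<lambda>q. h q) \<longlongrightarrow> 0\<^sup>2) (filtercomap (\<lambda>q. riem_dist A g q x0) at_top)"
      unfolding h_def using decay unfolding zero_at_infinity_def by (rule tendsto_power)
    then have "\<forall>\<^sub>F q in filtercomap (\<lambda>q. riem_dist A g q x0) at_top. h q < e"
      using e by (intro order_tendstoD(2)) simp_all
    then obtain R where R: "\<And>q. riem_dist A g q x0 \<ge> R \<Longrightarrow> h q < e"
      unfolding eventually_filtercomap_at_top_linorder by blast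
    \<comment> \<open>Outside this ball \<open>h < e\<close>; the second argument of
      \<open>max\<close> puts \<open>p\<close> inside.\<close>
    define B where "B = riem.mcball x0 (max R (riem_dist A g x0 p))"
    have pB: "p \<in> B" by (simp add: B_def)
    have "compact B" unfolding B_def by (rule compact_ball)
    moreover have "B \<noteq> {}" using pB by blast
    ultimately obtain q where q: "q \<in> B" "\<And>y. y \<in> B \<Longrightarrow> h y + e * exp (- u y) \<le> h q + e * exp (- u q)"
      using continuous_attains_sup[OF _ _ continuous_on_subset[OF cont subset_UNIV], of B e] by blast
    have exp1: "0 < exp (- u y)" "exp (- u y) < 1" for y
      by (simp_all add: u)
    have wp: "h p < h p + e * exp (- u p)" using e exp1(1)[of p] by simp
    have "h y + e * exp (- u y) \<le> h q + e * exp (- u q)" for y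
    proof (cases "y \<in> B")
      case False
      then have "R \<le> riem_dist A g y x0" by (simp add: B_def riem.commute)
      then have "h y < e" by (rule R)
      moreover have "e * exp (- u y) \<le> e * 1" using e exp1(2)[of y] by (intro mult_left_mono) simp_all
      ultimately have "h y + e * exp (- u y) < h p" by (simp add: e_def)
      then show ?thesis using wp q(2)[OF pB] by linarith
    qed (rule q(2))
    \<comment> \<open>The perturbation accounts for at most \<open>e\<close> of a maximum that
      exceeds \<open>2 * e\<close>; the rest is \<open>h q\<close>.\<close>
    moreover have "h q > 0"
    proof -
      have "e * exp (- u q) \<le> e * 1" using e exp1(2)[of q] by (intro mult_left_mono) simp_all
      then show ?thesis using wp q(2)[OF pB] hp unfolding e_def by linarith
    qed
    ultimately show False by (rule no_max[OF e])
  qed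
  \<comment> \<open>With \<open>h\<close> zero the gradient vanishes, so \<open>u\<close> is
    constant on coordinate balls and connectedness spreads this to the manifold.\<close>
  have "u constant_on UNIV"
  proof (rule locally_constant_imp_constant[OF conn])
    fix p
    define c where "c = chart_at A p"
    have c: "c \<in> A" and p: "p \<in> chart_dom c" using chart_at by (auto simp: c_def)
    interpret conformal_chart "chart_image c" "g c" "u \<circ> param c" "\<psi> c" by (rule chart[OF c])
    obtain r where r: "r > 0" "ball (coord c p) r \<subseteq> chart_image c"
      using open_chart_image[OF c] coord_in_image[OF p] open_contains_ball by blast
    have der: "((u \<circ> param c) has_derivative (\<lambda>v. 0)) (at x within ball (coord c p) r)" if "x \<in> ball (coord c p) r" for x
    proof -
      have x: "x \<in> chart_image c" using that r(2) by blast
      have "coord_inner (g c) x (X x) (X x) = 0"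
        using h_eq[OF c param_in_dom[OF x]] h0 by (simp add: gradient_def coord_param[OF c x])
      then have "X x = 0" using metric_pos[OF c x, of "X x"] by fastforce
      then have "pdiff i (u \<circ> param c) x = 0" for i by (simp add: pdiff_U[OF x])
      then show ?thesis
        using has_derivative_pdiff[OF diffU[OF c x]] by (simp add: has_derivative_at_withinI)
    qed
    let ?T = "param c ` ball (coord c p) r"
    have pT: "p \<in> ?T"
      using r(1) param_coord[OF c p] by (intro image_eqI[of _ _ "coord c p"]) simp_all
    have const: "u y = u p" if y: "y \<in> ?T" for y
    proof -
      obtain z where z: "z \<in> ball (coord c p) r" "y = param c z" using y by blast
      have "(u \<circ> param c) z = (u \<circ> param c) (coord c p)"
        using r(1) z(1) by (intro has_derivative_zero_unique[OF convex_ball der]) simp_all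
      then show ?thesis using z(2) param_coord[OF c p] by simp
    qed
    have "openin (top_of_set UNIV) ?T"
      using open_param_image[OF c open_ball r(2)] by simp
    with pT const show "\<exists>T. openin (top_of_set UNIV) T \<and> p \<in> T \<and> (\<forall>x\<in>T. u x = u p)"
      by (intro exI[of _ ?T] conjI ballI)
  qed
  then obtain k where k: "\<And>p. exp (- f p / m) = k"
    by (auto simp: constant_on_def u)
  have "f p = f x0" for p
  proof -
    have "exp (- f p / m) = exp (- f x0 / m)" by (simp only: k)
    then show ?thesis using m by simp
  qed
  then show ?thesis unfolding constant_on_def by blast
qed

end
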